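(* Let $\mathcal{L}=\mathcal{S}\dot{+}\mathcal{I}$ be a semisimple Leibniz algebra, where $\mathcal{I}=\mathrm{span}\{[x,x]:x\in\mathcal{L}\}$ and $\mathcal{S}$ is a semisimple Lie subalgebra. Let $$\mathcal{S}=\bigoplus_{i=1}^r n_i\mathcal{S}_i$$ be a decomposition into the sum of simple Lie ideals, where $\mathcal{S}_i\not\simeq\mathcal{S}_j$ if $i\ne j$, and let $$\mathcal{I}=\bigoplus_{i=1}^{r+s}m_i\mathcal{I}_i$$ be a decomposition into the sum of simple $\mathcal{S}$-modules, where $\mathcal{I}_i\not\simeq\mathcal{I}_j$ if $i\neq j$, and where for $i\in\{1,\dots,r\}$ one has $\mathcal{S}_i\simeq\mathcal{I}_i$ as $\mathcal{S}$-modules and $m_i\ge 0$. Then: (a) each $d\in\mathrm{Der}(\mathcal{L})_{\mathcal{S},\mathcal{I}}$ is uniquely determined by a map in $\bigoplus_{i=1}^r\mathrm{Hom}_{\mathbb{C}}(\mathbb{C}^{n_i},\mathbb{C}^{m_i})$; (b) each $d\in\mathrm{Der}(\mathcal{L})_{\mathcal{I},\mathcal{I}}$ is uniquely determined by a map in $\bigoplus_{i=1}^{r+s}\mathrm{Hom}_{\mathbb{C}}(\mathbb{C}^{m_i},\mathbb{C}^{m_i})$; (c) $\displaystyle\dim\mathrm{Der}(\mathcal{L})=\dim\mathcal{S}+\sum_{i=1}^r n_im_i+\sum_{i=1}^{r+s}m_i^2.$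
   Context: All vector spaces and algebras are finite-dimensional over $\mathbb{C}$. A (right) Leibniz algebra is a vector space $\mathcal{L}$ with a bilinear bracket satisfying $[x,[y,z]]=[[x,y],z]-[[x,z],y]$ for all $x,y,z$. The subspace $\mathcal{I}=\mathrm{span}\{[x,x]:x\in\mathcal{L}\}$ is an ideal with $[\mathcal{L},\mathcal{I}]=0$, and $\mathcal{L}/\mathcal{I}$ is a Lie algebra. $\mathcal{L}$ is called semisimple if $\mathcal{L}/\mathcal{I}$ is a semisimple Lie algebra. In that case $\mathcal{L}=\mathcal{S}\dot{+}\mathcal{I}$ (direct sum of subspaces) with $\mathcal{S}$ a semisimple Lie subalgebra. $\mathcal{I}$ is a right $\mathcal{S}$-module via $v.x=[v,x]$, and $\mathcal{S}$ and each of its ideals is a right $\mathcal{S}$-module via $y.x=[y,x]$. In the decomposition of $\mathcal{S}$, $n_i\mathcal{S}_i$ denotes a direct sum of $n_i$ copies of the simple Lie algebra $\mathcal{S}_i$, occurring as ideals of $\mathcal{S}$. In the decomposition of $\mathcal{I}$, $m_i\mathcal{I}_i$ denotes a direct sum of $m_i$ copies of the simple $\mathcal{S}$-module $\mathcal{I}_i$. A derivation of $\mathcal{L}$ is a linear map $d:\mathcal{L}\to\mathcal{L}$ with $d([x,y])=[d(x),y]+[x,d(y)]$ for all $x,y$. $\mathrm{Der}(\mathcal{L})$ is the Lie algebra of derivations of $\mathcal{L}$, and $$\mathrm{Der}(\mathcal{L})_{\mathcal{S},\mathcal{I}}=\{d\in\mathrm{Der}(\mathcal{L}):d(\mathcal{S})\subset\mathcal{I},\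 d(\mathcal{I})=0\},$$ $$\mathrm{Der}(\mathcal{L})_{\mathcal{I},\mathcal{I}}=\{d\in\mathrm{Der}(\mathcal{L}):d(\mathcal{I})\subset\mathcal{I},\ d(\mathcal{S})=0\}.$$
   Formalization: Each of the n_i copies of S_i is required to be isomorphic to S_i (hence I_i) as an S-module, not only as a Lie algebra, which forces n_i=1; S_i≄S_j is meant as S-modules. Otherwise (c) fails: S=sl2+sl2, n_1=2, I adjoint of one factor gives 9, not 8. Every L is still covered. *)

theory Defs
  imports Complex_Main "HOL-Library.Function_Algebras" "HOL-Library.FuncSet"
begin

section \<open>Algebras given by a carrier and operations\<close>

text \<open>The Leibniz algebra itself lives on a whole type. Carriers are needed to treat
  subalgebras and the quotient by the Leibniz kernel as Lie algebras in their own right.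
  The predicates of this section are meant for structures that are already known to be
  Lie algebras.\<close>

record 'a lie_struct =
  lcarrier :: "'a set"
  lzero :: 'a
  ladd :: "'a \<Rightarrow> 'a \<Rightarrow> 'a"
  lscale :: "complex \<Rightarrow> 'a \<Rightarrow> 'a"
  lbracket :: "'a \<Rightarrow> 'a \<Rightarrow> 'a"

definition lie_subspace :: "'a lie_struct \<Rightarrow> 'a set \<Rightarrow> bool" where
  "lie_subspace G U \<longleftrightarrow> U \<subseteq> lcarrier G \<and> lzero G \<in> U \<and>
     (\<forall>x\<in>U. \<forall>y\<in>U. ladd G x y \<in> U) \<and> (\<forall>c. \<forall>x\<in>U. lscale G c x \<in> U)"

definition lie_span :: "'a lie_struct \<Rightarrow> 'a set \<Rightarrow> 'a set" where
  "lie_span G X = \<Inter>{U. lie_subspace G U \<and> X \<subseteq> U}"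

definition lie_ideal :: "'a lie_struct \<Rightarrow> 'a set \<Rightarrow> bool" where
  "lie_ideal G J \<longleftrightarrow> lie_subspace G J \<and>
     (\<forall>x\<in>J. \<forall>y\<in>lcarrier G. lbracket G x y \<in> J \<and> lbracket G y x \<in> J)"

definition derived_space :: "'a lie_struct \<Rightarrow> 'a set \<Rightarrow> 'a set" where
  "derived_space G J = lie_span G {lbracket G x y | x y. x \<in> J \<and> y \<in> J}"

definition lie_solvable :: "'a lie_struct \<Rightarrow> 'a set \<Rightarrow> bool" where
  "lie_solvable G J \<longleftrightarrow> (\<exists>k. (derived_space G ^^ k) J = {lzero G})"

definition semisimple_lie :: "'a lie_struct \<Rightarrow> bool" where
  "semisimple_lie G \<longleftrightarrow> (\<forall>J. lie_ideal G J \<and> lie_solvable G J \<longrightarrow> J = {lzero G})"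

definition simple_lie :: "'a lie_struct \<Rightarrow> bool" where
  "simple_lie G \<longleftrightarrow> (\<exists>x\<in>lcarrier G. \<exists>y\<in>lcarrier G. lbracket G x y \<noteq> lzero G) \<and>
     (\<forall>J. lie_ideal G J \<longrightarrow> J = {lzero G} \<or> J = lcarrier G)"

definition lie_isomorphic :: "'a lie_struct \<Rightarrow> 'b lie_struct \<Rightarrow> bool" where
  "lie_isomorphic G H \<longleftrightarrow> (\<exists>f. bij_betw f (lcarrier G) (lcarrier H) \<and>
     (\<forall>x\<in>lcarrier G. \<forall>y\<in>lcarrier G. f (ladd G x y) = ladd H (f x) (f y)) \<and>
     (\<forall>c. \<forall>x\<in>lcarrier G. f (lscale G c x) = lscale H c (f x)) \<and>
     (\<forall>x\<in>lcarrier G. \<forall>y\<in>lcarrier G. f (lbracket G x y) = lbracket H (f x) (f y)))"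


section \<open>Leibniz algebras\<close>

locale leibniz_algebra = vector_space scl
  for scl :: "complex \<Rightarrow> 'a::ab_group_add \<Rightarrow> 'a" +
  fixes br :: "'a \<Rightarrow> 'a \<Rightarrow> 'a"
  assumes finite_dim: "\<exists>B. finite B \<and> span B = UNIV"
    and linear_left: "Vector_Spaces.linear scl scl (\<lambda>x. br x y)"
    and linear_right: "Vector_Spaces.linear scl scl (\<lambda>y. br x y)"
    and leibniz: "br x (br y z) = br (br x y) z - br (br x z) y"

abbreviation vs_dim :: "(complex \<Rightarrow> 'a::ab_group_add \<Rightarrow> 'a) \<Rightarrow> 'a set \<Rightarrow> nat" where
  "vs_dim \<equiv> vector_space.dim"

definition leib_kernel :: "(complex \<Rightarrow> 'a::ab_group_add \<Rightarrow> 'a) \<Rightarrow> ('a \<Rightarrow> 'a \<Rightarrow> 'a) \<Rightarrow> 'a set" where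
  "leib_kernel scl br = module.span scl (range (\<lambda>x. br x x))"

definition substruct ::
  "(complex \<Rightarrow> 'a::ab_group_add \<Rightarrow> 'a) \<Rightarrow> ('a \<Rightarrow> 'a \<Rightarrow> 'a) \<Rightarrow> 'a set \<Rightarrow> 'a lie_struct" where
  "substruct scl br S =
     \<lparr>lcarrier = S, lzero = 0, ladd = (+), lscale = scl, lbracket = br\<rparr>"

text \<open>The elements are the cosets of \<open>I\<close>. Adding \<open>v \<in> I\<close> to scalar multiples and brackets
  of representatives turns the result into a full coset; it is a single one if \<open>I\<close> is an
  ideal.\<close>

definition quotient_struct ::
  "(complex \<Rightarrow> 'a::ab_group_add \<Rightarrow> 'a) \<Rightarrow> ('a \<Rightarrow> 'a \<Rightarrow> 'a) \<Rightarrow> 'a set \<Rightarrow> 'a set lie_struct" where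
  "quotient_struct scl br I =
     \<lparr>lcarrier = {{x + v | v. v \<in> I} | x. True},
      lzero = I,
      ladd = (\<lambda>A B. {a + b | a b. a \<in> A \<and> b \<in> B}),
      lscale = (\<lambda>c A. {scl c a + v | a v. a \<in> A \<and> v \<in> I}),
      lbracket = (\<lambda>A B. {br a b + v | a b v. a \<in> A \<and> b \<in> B \<and> v \<in> I})\<rparr>"

definition semisimple_leibniz ::
  "(complex \<Rightarrow> 'a::ab_group_add \<Rightarrow> 'a) \<Rightarrow> ('a \<Rightarrow> 'a \<Rightarrow> 'a) \<Rightarrow> bool" where
  "semisimple_leibniz scl br \<longleftrightarrow>
     semisimple_lie (quotient_struct scl br (leib_kernel scl br))"

text \<open>The Jacobi identity on \<open>S\<close> is inherited: for an alternating bracket it is the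
  Leibniz identity.\<close>

definition lie_subalgebra ::
  "(complex \<Rightarrow> 'a::ab_group_add \<Rightarrow> 'a) \<Rightarrow> ('a \<Rightarrow> 'a \<Rightarrow> 'a) \<Rightarrow> 'a set \<Rightarrow> bool" where
  "lie_subalgebra scl br S \<longleftrightarrow> module.subspace scl S \<and>
     (\<forall>x\<in>S. \<forall>y\<in>S. br x y \<in> S) \<and> (\<forall>x\<in>S. br x x = 0)"

text \<open>Meant for finite \<open>A\<close> and subspaces \<open>U j\<close>.\<close>

definition direct_sum_decomp :: "'i set \<Rightarrow> ('i \<Rightarrow> 'a::ab_group_add set) \<Rightarrow> 'a set \<Rightarrow> bool" where
  "direct_sum_decomp A U W \<longleftrightarrow> bij_betw (\<lambda>x. \<Sum>j\<in>A. x j) (\<Pi>\<^sub>E j\<in>A. U j) W"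


section \<open>Right modules over a Lie subalgebra\<close>

record ('v, 'a) rmod =
  mcarrier :: "'v set"
  mscale :: "complex \<Rightarrow> 'v \<Rightarrow> 'v"
  mact :: "'v \<Rightarrow> 'a \<Rightarrow> 'v"

definition linear_on ::
  "(complex \<Rightarrow> 'v::ab_group_add \<Rightarrow> 'v) \<Rightarrow> (complex \<Rightarrow> 'w::ab_group_add \<Rightarrow> 'w) \<Rightarrow>
   'v set \<Rightarrow> ('v \<Rightarrow> 'w) \<Rightarrow> bool" where
  "linear_on sv sw V f \<longleftrightarrow>
     (\<forall>x\<in>V. \<forall>y\<in>V. f (x + y) = f x + f y) \<and> (\<forall>c. \<forall>x\<in>V. f (sv c x) = sw c (f x))"

definition rmodule ::
  "(complex \<Rightarrow> 'a::ab_group_add \<Rightarrow> 'a) \<Rightarrow> ('a \<Rightarrow> 'a \<Rightarrow> 'a) \<Rightarrow> 'a set \<Rightarrow>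
   ('v::ab_group_add, 'a) rmod \<Rightarrow> bool" where
  "rmodule scl br S M \<longleftrightarrow>
     vector_space (mscale M) \<and> module.subspace (mscale M) (mcarrier M) \<and>
     (\<forall>v\<in>mcarrier M. \<forall>x\<in>S. mact M v x \<in> mcarrier M) \<and>
     (\<forall>x\<in>S. linear_on (mscale M) (mscale M) (mcarrier M) (\<lambda>v. mact M v x)) \<and>
     (\<forall>v\<in>mcarrier M. linear_on scl (mscale M) S (mact M v)) \<and>
     (\<forall>v\<in>mcarrier M. \<forall>x\<in>S. \<forall>y\<in>S.
        mact M v (br x y) = mact M (mact M v x) y - mact M (mact M v y) x)"

definition submodule_of :: "'a set \<Rightarrow> ('v::ab_group_add, 'a) rmod \<Rightarrow> 'v set \<Rightarrow> bool" where
  "submodule_of S M W \<longleftrightarrow> W \<subseteq> mcarrier M \<and> module.subspace (mscale M) W \<and>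
     (\<forall>v\<in>W. \<forall>x\<in>S. mact M v x \<in> W)"

definition simple_rmodule ::
  "(complex \<Rightarrow> 'a::ab_group_add \<Rightarrow> 'a) \<Rightarrow> ('a \<Rightarrow> 'a \<Rightarrow> 'a) \<Rightarrow> 'a set \<Rightarrow>
   ('v::ab_group_add, 'a) rmod \<Rightarrow> bool" where
  "simple_rmodule scl br S M \<longleftrightarrow> rmodule scl br S M \<and> mcarrier M \<noteq> {0} \<and>
     (\<forall>W. submodule_of S M W \<longrightarrow> W = {0} \<or> W = mcarrier M)"

definition rmod_iso ::
  "'a set \<Rightarrow> ('v::ab_group_add, 'a) rmod \<Rightarrow> ('w::ab_group_add, 'a) rmod \<Rightarrow> ('v \<Rightarrow> 'w) \<Rightarrow> bool" where
  "rmod_iso S M N f \<longleftrightarrow> bij_betw f (mcarrier M) (mcarrier N) \<and>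
     linear_on (mscale M) (mscale N) (mcarrier M) f \<and>
     (\<forall>v\<in>mcarrier M. \<forall>x\<in>S. f (mact M v x) = mact N (f v) x)"

definition rmod_isomorphic ::
  "'a set \<Rightarrow> ('v::ab_group_add, 'a) rmod \<Rightarrow> ('w::ab_group_add, 'a) rmod \<Rightarrow> bool" where
  "rmod_isomorphic S M N \<longleftrightarrow> (\<exists>f. rmod_iso S M N f)"

text \<open>A subspace of the Leibniz algebra that is stable under \<open>v \<mapsto> [v,x]\<close>, as a right module.\<close>

definition bracket_rmod ::
  "(complex \<Rightarrow> 'a::ab_group_add \<Rightarrow> 'a) \<Rightarrow> ('a \<Rightarrow> 'a \<Rightarrow> 'a) \<Rightarrow> 'a set \<Rightarrow> ('a, 'a) rmod" where
  "bracket_rmod scl br J = \<lparr>mcarrier = J, mscale = scl, mact = br\<rparr>"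


section \<open>Derivations\<close>

definition Der ::
  "(complex \<Rightarrow> 'a::ab_group_add \<Rightarrow> 'a) \<Rightarrow> ('a \<Rightarrow> 'a \<Rightarrow> 'a) \<Rightarrow> ('a \<Rightarrow> 'a) set" where
  "Der scl br = {d. Vector_Spaces.linear scl scl d \<and>
     (\<forall>x y. d (br x y) = br (d x) y + br x (d y))}"

definition Der_SI ::
  "(complex \<Rightarrow> 'a::ab_group_add \<Rightarrow> 'a) \<Rightarrow> ('a \<Rightarrow> 'a \<Rightarrow> 'a) \<Rightarrow> 'a set \<Rightarrow> 'a set \<Rightarrow> ('a \<Rightarrow> 'a) set" where
  "Der_SI scl br S I = {d \<in> Der scl br. d ` S \<subseteq> I \<and> (\<forall>v\<in>I. d v = 0)}"

definition Der_II ::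
  "(complex \<Rightarrow> 'a::ab_group_add \<Rightarrow> 'a) \<Rightarrow> ('a \<Rightarrow> 'a \<Rightarrow> 'a) \<Rightarrow> 'a set \<Rightarrow> 'a set \<Rightarrow> ('a \<Rightarrow> 'a) set" where
  "Der_II scl br S I = {d \<in> Der scl br. d ` I \<subseteq> I \<and> (\<forall>x\<in>S. d x = 0)}"

definition fun_scale :: "(complex \<Rightarrow> 'a \<Rightarrow> 'a) \<Rightarrow> complex \<Rightarrow> ('x \<Rightarrow> 'a) \<Rightarrow> ('x \<Rightarrow> 'a)" where
  "fun_scale scl c f = (\<lambda>x. scl c (f x))"


section \<open>Direct sums of spaces of linear maps between coordinate spaces\<close>

text \<open>\<open>cspace n\<close> is \<open>\<complex>\<^sup>n\<close>, with coordinates indexed by \<open>0, \<dots>, n - 1\<close>. Maps in \<open>Hom_C n m\<close>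
  are \<open>0\<close> outside \<open>\<complex>\<^sup>n\<close>, so that a linear map \<open>\<complex>\<^sup>n \<rightarrow> \<complex>\<^sup>m\<close> is represented exactly once and
  the pointwise operations of functions are the operations of \<open>Hom\<close>. An element of
  \<open>Hom_sum p n m\<close> is a family in the direct sum of the \<open>Hom(\<complex>\<^sup>n\<^sub>i, \<complex>\<^sup>m\<^sub>i)\<close> for \<open>i < p\<close>,
  with \<open>n\<^sub>i = n i\<close> and \<open>m\<^sub>i = m i\<close>, continued by \<open>0\<close>.\<close>

type_synonym cvec = "nat \<Rightarrow> complex"

definition cspace :: "nat \<Rightarrow> cvec set" where
  "cspace n = {v. \<forall>k\<ge>n. v k = 0}"

definition Hom_C :: "nat \<Rightarrow> nat \<Rightarrow> (cvec \<Rightarrow> cvec) set" where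
  "Hom_C n m = {f. f ` cspace n \<subseteq> cspace m \<and>
     linear_on (fun_scale (*)) (fun_scale (*)) (cspace n) f \<and> (\<forall>v. v \<notin> cspace n \<longrightarrow> f v = 0)}"

definition Hom_sum :: "nat \<Rightarrow> (nat \<Rightarrow> nat) \<Rightarrow> (nat \<Rightarrow> nat) \<Rightarrow> (nat \<Rightarrow> cvec \<Rightarrow> cvec) set" where
  "Hom_sum p n m = {F. (\<forall>i<p. F i \<in> Hom_C (n i) (m i)) \<and> (\<forall>i\<ge>p. F i = 0)}"

definition Hom_scale :: "complex \<Rightarrow> (nat \<Rightarrow> cvec \<Rightarrow> cvec) \<Rightarrow> (nat \<Rightarrow> cvec \<Rightarrow> cvec)" where
  "Hom_scale = fun_scale (fun_scale (fun_scale (*)))"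

end

theory Submission
  imports Defs "HOL-Computational_Algebra.Fundamental_Theorem_Algebra"
begin

text \<open>A derivation \<open>d\<close> preserves \<open>I\<close>, so modulo \<open>I\<close> it is a derivation of the semisimple Lie
  algebra \<open>S\<close> and hence inner there. Subtracting a right multiplication by an element of \<open>S\<close>
  leaves a derivation with values in \<open>I\<close>; since \<open>[L, I] = 0\<close>, such a derivation is the same thing
  as a pair of \<open>S\<close>-module homomorphisms \<open>S \<rightarrow> I\<close> and \<open>I \<rightarrow> I\<close>, and these are matrices by Schur's
  lemma. That derivations of \<open>S\<close> are inner follows from the nondegeneracy of the Killing form.\<close>

section \<open>Generalized eigenspaces and the trace\<close>

text \<open>Right multiplication \<open>x \<mapsto> [x, a]\<close> is a derivation by the right
  Leibniz identity and depends only on \<open>a\<close> modulo \<open>I\<close>; hence the summand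
  \<open>dim S\<close>. A derivation need not preserve \<open>S\<close>, so what is shown to be
  inner is its compression to \<open>S\<close> along \<open>I\<close>. The right multiplications
  meet the derivations with values in \<open>I\<close> only in \<open>0\<close>, because
  \<open>a \<in> S\<close> with \<open>[S, a] \<subseteq> I\<close> must vanish; this again rests on
  the Killing form.

  The homomorphisms \<open>S \<rightarrow> I\<close> and \<open>I \<rightarrow> I\<close> are two
  instances of one computation: between a sum of \<open>n i\<close> copies and a sum of
  \<open>m i\<close> copies of the same simple modules there is one scalar for each pair of copies
  of the same module, which gives \<open>n i * m i\<close> and \<open>(m i)\<^sup>2\<close>.

  An obstacle is that the abstract simple modules live in a type of their own, for which no
  finiteness is recorded. The eigenvalue in Schur's lemma is therefore found in a copy inside the
  Leibniz algebra.\<close>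

locale complex_fd = finite_dimensional_vector_space scale Basis
  for scale :: "complex \<Rightarrow> 'a::ab_group_add \<Rightarrow> 'a" (infixr \<open>*s\<close> 75) and Basis
begin

sublocale pair: vector_space_pair scale scale ..

abbreviation lin :: "('a \<Rightarrow> 'a) \<Rightarrow> bool" where
  "lin \<equiv> Vector_Spaces.linear (*s) (*s)"

lemmas lin_add = pair.linear_add
  and lin_scale = pair.linear_scale
  and lin_diff = pair.linear_diff
  and lin_zero = pair.linear_0
  and lin_sum = pair.linear_sum

lemma lin_iff: "lin f \<longleftrightarrow> (\<forall>x y. f (x + y) = f x + f y) \<and> (\<forall>c x. f (c *s x) = c *s f x)"
  using vector_space_axioms unfolding Vector_Spaces.linear_iff by blast

lemma lin_comp: "lin f \<Longrightarrow> lin g \<Longrightarrow> lin (\<lambda>x. f (g x))"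
  by (auto simp: lin_iff)

section \<open>Polynomials in an endomorphism and eigenvectors modulo a subspace\<close>

text \<open>This is \<open>p(f) u\<close> in Horner form. Evaluating at a vector keeps all
  computations inside the vector space instead of a ring of operators.\<close>

definition poly_apply :: "('a \<Rightarrow> 'a) \<Rightarrow> complex poly \<Rightarrow> 'a \<Rightarrow> 'a" where
  "poly_apply f p u = fold_coeffs (\<lambda>a w. a *s u + f w) p 0"

lemma poly_apply_0 [simp]: "poly_apply f 0 u = 0"
  by (simp add: poly_apply_def)

lemma poly_apply_pCons:
  assumes f: "lin f"
  shows "poly_apply f (pCons a p) u = a *s u + f (poly_apply f p u)"
  by (cases "p = 0 \<and> a = 0") (auto simp: poly_apply_def lin_zero[OF f])

lemma poly_apply_add:
  assumes f: "lin f"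
  shows "poly_apply f (p + q) u = poly_apply f p u + poly_apply f q u"
  by (induction p q rule: poly_induct2)
     (simp_all add: poly_apply_pCons[OF f] lin_add[OF f] scale_left_distrib algebra_simps)

lemma poly_apply_smult:
  assumes f: "lin f"
  shows "poly_apply f (smult c p) u = c *s poly_apply f p u"
  by (induction p) (simp_all add: poly_apply_pCons[OF f] lin_scale[OF f] scale_right_distrib)

lemma poly_apply_diff:
  assumes f: "lin f"
  shows "poly_apply f (p - q) u = poly_apply f p u - poly_apply f q u"
  using poly_apply_add[OF f, of p "smult (-1) q" u] poly_apply_smult[OF f, of "-1" q u] by simp

lemma poly_apply_monom:
  assumes f: "lin f"
  shows "poly_apply f (monom 1 k) u = (f ^^ k) u"
  by (induction k) (simp_all add: poly_apply_pCons[OF f] monom_0 monom_Suc lin_zero[OF f])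

lemma poly_apply_linear_factor:
  assumes f: "lin f"
  shows "poly_apply f ([:- c, 1:] * q) u = f (poly_apply f q u) - c *s poly_apply f q u"
proof -
  have "[:- c, 1:] * q = smult (- c) q + pCons 0 q" by simp
  then show ?thesis using assms by (simp only: poly_apply_add[OF f] poly_apply_smult[OF f] poly_apply_pCons[OF f]) simp
qed

lemma poly_apply_in:
  assumes f: "lin f" and "subspace U" "f ` U \<subseteq> U" "u \<in> U"
  shows "poly_apply f p u \<in> U"
  using assms by (induction p) (auto simp: poly_apply_pCons[OF f] subspace_0 intro!: subspace_add subspace_scale)

text \<open>The iterates of \<open>u\<close> cannot stay independent in finite dimension; a
  dependence of one of them on its predecessors is the polynomial.\<close>

lemma annihilating_poly_exists:
  assumes f: "lin f"
  shows "\<exists>p. p \<noteq> 0 \<and> poly_apply f p u = 0"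
proof -
  define v where "v i = (f ^^ i) u" for i
  have "\<exists>k. v k \<in> span (v ` {..<k})"
  proof (rule ccontr)
    assume "\<not> ?thesis"
    then have *: "v k \<notin> span (v ` {..<k})" for k by blast
    have "independent (v ` {..<k}) \<and> card (v ` {..<k}) = k" for k
    proof (induction k)
      case (Suc k)
      have "v k \<notin> v ` {..<k}" using *[of k] span_base[of "v k" "v ` {..<k}"] by blast
      moreover have "independent (insert (v k) (v ` {..<k}))"
        using independent_insertI[OF *[of k]] Suc.IH by blast
      ultimately show ?case using Suc.IH by (simp add: lessThan_Suc)
    qed (simp add: independent_empty)
    from this[of "Suc dimension"] show False
      using independent_card_le_dim[of "v ` {..<Suc dimension}" UNIV] by (simp add: dimension_def)
  qed
  then obtain k where k: "v k \<in> span (v ` {..<k})" by blast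
  \<comment> \<open>The values \<open>q(f) u\<close> for \<open>q\<close> of degree below
    \<open>k\<close>. Vanishing coefficients express the bound so that \<open>k = 0\<close> admits
    only \<open>q = 0\<close>.\<close>
  let ?T = "{w. \<exists>q. (\<forall>i\<ge>k. coeff q i = 0) \<and> w = poly_apply f q u}"
  have "subspace ?T"
  proof (rule subspaceI)
    show "0 \<in> ?T" by (auto intro!: exI[of _ 0])
    show "x + y \<in> ?T" if "x \<in> ?T" "y \<in> ?T" for x y
    proof -
      from that obtain p q where "\<forall>i\<ge>k. coeff p i = 0" "x = poly_apply f p u"
        "\<forall>i\<ge>k. coeff q i = 0" "y = poly_apply f q u" by auto
      then show ?thesis using f by (auto intro!: exI[of _ "p + q"] simp: poly_apply_add[OF f])
    qed
    show "c *s x \<in> ?T" if "x \<in> ?T" for c x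
    proof -
      from that obtain p where "\<forall>i\<ge>k. coeff p i = 0" "x = poly_apply f p u" by auto
      then show ?thesis using f by (auto intro!: exI[of _ "smult c p"] simp: poly_apply_smult[OF f])
    qed
  qed
  moreover have "v i \<in> ?T" if "i < k" for i
    using that f by (auto simp: v_def poly_apply_monom[OF f] intro!: exI[of _ "monom 1 i"])
  ultimately have "span (v ` {..<k}) \<subseteq> ?T" by (intro span_minimal) auto
  with k obtain q where q: "\<forall>i\<ge>k. coeff q i = 0" "v k = poly_apply f q u" by auto
  have "coeff (monom 1 k - q) k = 1" using q by simp
  then have "monom 1 k - q \<noteq> 0" by (metis coeff_0 zero_neq_one)
  moreover have "poly_apply f (monom 1 k - q) u = 0"
    using q f by (simp add: poly_apply_diff[OF f] poly_apply_monom[OF f] v_def)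
  ultimately show ?thesis by blast
qed

text \<open>Among the nonzero \<open>p\<close> with \<open>p(f) u \<in> W\<close> take one of least
  degree. It is not constant, so it has a root \<open>c\<close>, and its cofactor by
  \<open>X - c\<close> carries \<open>u\<close> to the required vector. With \<open>W = {0}\<close>
  this is an ordinary eigenvector; with \<open>W\<close> the span of the generalized eigenspaces it
  drives \<open>span_genspaces\<close>.\<close>

lemma eigenvector_mod_subspace:
  assumes f: "lin f" and U: "subspace U" "f ` U \<subseteq> U" and W: "subspace W"
    and u: "u \<in> U" "u \<notin> W"
  shows "\<exists>v\<in>U. v \<notin> W \<and> (\<exists>c. f v - c *s v \<in> W)"
proof -
  let ?P = "\<lambda>p. p \<noteq> 0 \<and> poly_apply f p u \<in> W"
  have "\<exists>p. ?P p" using annihilating_poly_exists[OF f, of u] W subspace_0 by metis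
  then obtain p where p: "?P p" and min: "\<And>q. ?P q \<Longrightarrow> degree p \<le> degree q"
    using ex_has_least_nat[of ?P _ degree] by metis
  have "degree p \<noteq> 0"
  proof
    assume "degree p = 0"
    then obtain c where c: "p = [:c:]" by (meson degree_eq_zeroE)
    with p have "c \<noteq> 0" "c *s u \<in> W" using f by (auto simp: poly_apply_pCons[OF f] lin_zero[OF f])
    then have "inverse c *s (c *s u) \<in> W" using W subspace_scale by blast
    then show False using u \<open>c \<noteq> 0\<close> by simp
  qed
  then obtain c where "poly p c = 0"
    using fundamental_theorem_of_algebra[of p] constant_degree[of p] by auto
  then obtain q where q: "p = [:- c, 1:] * q" by (metis poly_eq_0_iff_dvd dvdE)
  with p have "q \<noteq> 0" by auto
  then have "degree p = Suc (degree q)" unfolding q by (subst degree_mult_eq) auto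
  with min[of q] \<open>q \<noteq> 0\<close> have "poly_apply f q u \<notin> W" by auto
  moreover have "f (poly_apply f q u) - c *s poly_apply f q u \<in> W"
    using p f by (simp only: q poly_apply_linear_factor[OF f])
  ultimately show ?thesis using poly_apply_in[OF f U u(1)] by blast
qed

text \<open>The inductive form of: some power of \<open>f - c\<close> annihilates \<open>v\<close>.\<close>

inductive_set genspace :: "('a \<Rightarrow> 'a) \<Rightarrow> complex \<Rightarrow> 'a set" for f c where
  zero: "0 \<in> genspace f c"
| step: "f v - c *s v \<in> genspace f c \<Longrightarrow> v \<in> genspace f c"

section \<open>Generalized eigenspaces: spanning and independence\<close>

lemma genspace_stepI: "f v - c *s v = w \<Longrightarrow> w \<in> genspace f c \<Longrightarrow> v \<in> genspace f c"
  using genspace.step[of f v c] by simp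

lemma genspace_down:
  assumes f: "lin f"
  shows "v \<in> genspace f c \<Longrightarrow> f v - c *s v \<in> genspace f c"
  by (erule genspace.cases) (auto simp: lin_zero[OF f] genspace.zero)

lemma genspace_add:
  assumes f: "lin f"
  shows "x \<in> genspace f c \<Longrightarrow> y \<in> genspace f c \<Longrightarrow> x + y \<in> genspace f c"
proof (induction arbitrary: y rule: genspace.induct)
  case (step v)
  have "(f v - c *s v) + (f y - c *s y) \<in> genspace f c"
    using step genspace_down[OF f] by blast
  then show ?case
    by (rule genspace_stepI[rotated]) (simp add: lin_add[OF f] scale_right_distrib algebra_simps)
qed simp

lemma genspace_scale:
  assumes f: "lin f"
  shows "x \<in> genspace f c \<Longrightarrow> a *s x \<in> genspace f c"
proof (induction rule: genspace.induct)
  case (step v)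
  show ?case
    by (rule genspace_stepI[OF _ step.IH])
       (simp add: lin_scale[OF f] scale_right_diff_distrib mult.commute)
qed (simp add: genspace.zero)

lemma subspace_genspace: "lin f \<Longrightarrow> subspace (genspace f c)"
  by (rule subspaceI) (auto intro: genspace.zero genspace_add genspace_scale)

lemma genspace_invariant:
  assumes f: "lin f" and x: "x \<in> genspace f c" shows "f x \<in> genspace f c"
proof -
  have "(f x - c *s x) + c *s x \<in> genspace f c"
    by (rule genspace_add[OF f genspace_down[OF assms] genspace_scale[OF assms]])
  then show ?thesis by (simp only: diff_add_cancel)
qed

lemma genspace_invariant_shift:
  assumes f: "lin f" and x: "x \<in> genspace f c" shows "f x - d *s x \<in> genspace f c"
  using subspace_diff[OF subspace_genspace[OF f] genspace_invariant[OF assms] genspace_scale[OF assms]] by this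

text \<open>The sequence obtained from \<open>x\<close> by iterating \<open>f - c\<close> ends in
  \<open>0 \<in> W\<close>, so it has a last term outside \<open>W\<close>, which stability keeps in
  \<open>U\<close>. This one device yields true eigenvectors, triangular bases and the last step of
  Engel's theorem.\<close>

lemma genspace_reduce:
  assumes f: "lin f" and W: "subspace W"
  shows "x \<in> genspace f c \<Longrightarrow> x \<in> U \<Longrightarrow> x \<notin> W \<Longrightarrow> (\<And>u. u \<in> U \<Longrightarrow> f u - c *s u \<in> U) \<Longrightarrow>
    \<exists>v\<in>genspace f c. v \<in> U \<and> v \<notin> W \<and> f v - c *s v \<in> W"
proof (induction rule: genspace.induct)
  case zero
  then show ?case using W subspace_0 by blast
next
  case (step v)
  then show ?case
    using genspace.step[OF step.hyps] by (cases "f v - c *s v \<in> W") auto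
qed

text \<open>On an eigenvector for \<open>d\<close> the map \<open>f - c\<close> is the nonzero
  scalar \<open>d - c\<close>, yet some power of it annihilates the vector.\<close>

lemma genspace_shift_inj:
  assumes f: "lin f" and cd: "c \<noteq> d"
  shows "x \<in> genspace f c \<Longrightarrow> f x = d *s x \<Longrightarrow> x = 0"
proof (induction rule: genspace.induct)
  case (step v)
  have *: "f v - c *s v = (d - c) *s v" using step by (simp add: scale_left_diff_distrib)
  have "f (f v - c *s v) = d *s (f v - c *s v)" unfolding * using f step.prems
    by (simp add: lin_scale[OF f] mult.commute)
  then have "f v - c *s v = 0" using step.IH by simp
  then show ?case using cd * by simp
qed simp

text \<open>If \<open>y\<close> is a preimage of \<open>(f - c) v\<close> under
  \<open>f - d\<close>, then \<open>(f - d) (v - y) = (c - d) v\<close>, and \<open>c - d\<close>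
  can be divided out.\<close>

lemma genspace_shift_surj:
  assumes f: "lin f" and cd: "c \<noteq> d"
  shows "x \<in> genspace f c \<Longrightarrow> \<exists>y\<in>genspace f c. f y - d *s y = x"
proof (induction rule: genspace.induct)
  case zero
  then show ?case using f by (intro bexI[of _ 0]) (auto simp: lin_zero[OF f] genspace.zero)
next
  case (step v)
  then obtain y where y: "y \<in> genspace f c" "f y - d *s y = f v - c *s v" by blast
  have v: "v \<in> genspace f c" using step genspace.step by blast
  let ?z = "(1 / (c - d)) *s (v - y)"
  have "f (v - y) - d *s (v - y) = (c - d) *s v"
    using y f by (simp add: lin_diff[OF f] scale_left_diff_distrib scale_right_diff_distrib algebra_simps)
  then have "f ?z - d *s ?z = (1 / (c - d)) *s ((c - d) *s v)"
    by (metis lin_scale[OF f] scale_left_commute scale_right_diff_distrib)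
  also have "\<dots> = v" using cd by simp
  finally show ?case using y v f subspace_genspace
    by (intro bexI[of _ ?z]) (auto intro!: genspace_scale subspace_diff)
qed

lemma span_genspaces_shift_surj:
  assumes f: "lin f" and x: "x \<in> span (\<Union>c\<in>- {d}. genspace f c)"
  shows "\<exists>y\<in>span (\<Union>c\<in>- {d}. genspace f c). f y - d *s y = x"
  using x
proof (induction rule: span_induct_alt)
  case base
  then show ?case using f by (intro bexI[of _ 0]) (auto simp: lin_zero[OF f] span_zero)
next
  case (step a x z)
  then obtain y c where y: "y \<in> span (\<Union>c\<in>- {d}. genspace f c)" "f y - d *s y = z"
    and c: "c \<noteq> d" "x \<in> genspace f c" by auto
  obtain w where w: "w \<in> genspace f c" "f w - d *s w = x" using genspace_shift_surj[OF f c] by blast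
  have "w \<in> span (\<Union>c\<in>- {d}. genspace f c)" using w c by (intro span_base) auto
  then show ?case using y w f
    by (intro bexI[of _ "a *s w + y"])
       (auto simp: lin_add[OF f] lin_scale[OF f] scale_right_distrib scale_right_diff_distrib algebra_simps
         intro: span_add span_scale)
qed

text \<open>Otherwise there is an eigenvector \<open>v\<close> modulo the span, say for
  \<open>d\<close>. Since \<open>f - d\<close> is onto the span of the other generalized
  eigenspaces, \<open>v\<close> can be changed by an element \<open>w\<close> of that span so that
  \<open>(f - d) (v - w)\<close> lies in \<open>genspace f d\<close>. Then so does
  \<open>v - w\<close>, and \<open>v\<close> is in the span after all.\<close>

lemma span_genspaces:
  assumes f: "lin f"
  shows "span (\<Union>c. genspace f c) = UNIV"
proof (rule ccontr)
  let ?W = "span (\<Union>c. genspace f c)"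
  assume "?W \<noteq> UNIV"
  then obtain u where "u \<notin> ?W" by blast
  then obtain v d where v: "v \<notin> ?W" "f v - d *s v \<in> ?W"
    using eigenvector_mod_subspace[OF f subspace_UNIV _ subspace_span, of u] by blast
  have "(\<Union>c. genspace f c) = genspace f d \<union> (\<Union>c\<in>- {d}. genspace f c)" by auto
  with v obtain a b where ab: "f v - d *s v = a + b" "a \<in> span (genspace f d)"
    "b \<in> span (\<Union>c\<in>- {d}. genspace f c)"
    by (auto simp: span_Un)
  obtain w where w: "w \<in> span (\<Union>c\<in>- {d}. genspace f c)" "f w - d *s w = b"
    using span_genspaces_shift_surj[OF f ab(3)] by blast
  have a: "a \<in> genspace f d" using ab(2) subspace_genspace[OF f] by (metis span_eq_iff)
  have "f (v - w) - d *s (v - w) = a"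
    using ab w f by (simp add: lin_diff[OF f] scale_right_diff_distrib algebra_simps)
  then have "v - w \<in> genspace f d" using a by (blast intro: genspace_stepI)
  then have "v - w \<in> ?W" by (intro span_base) auto
  moreover have "w \<in> ?W" using w(1) span_mono[of "\<Union>c\<in>- {d}. genspace f c" "\<Union>c. genspace f c"] by blast
  ultimately have "(v - w) + w \<in> ?W" by (rule span_add)
  with v show False by simp
qed

text \<open>A relation puts \<open>w d\<close> both in \<open>genspace f d\<close> and in the sum
  \<open>X\<close> of the other spaces. If it is nonzero, reduction within \<open>X\<close> produces
  an eigenvector for \<open>d\<close>; by induction its components are annihilated by
  \<open>f - d\<close> too, which \<open>genspace_shift_inj\<close> forbids.\<close>

lemma genspace_sum_zero:
  assumes f: "lin f"
  shows "finite F \<Longrightarrow> (\<And>c. c \<in> F \<Longrightarrow> w c \<in> genspace f c) \<Longrightarrow> (\<Sum>c\<in>F. w c) = 0 \<Longrightarrow>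
    c \<in> F \<Longrightarrow> w c = 0"
proof (induction F arbitrary: w c rule: finite_induct)
  case (insert d F)
  define X where "X = {\<Sum>c\<in>F. w c | w. \<forall>c\<in>F. w c \<in> genspace f c}"
  have wd: "- w d \<in> genspace f d"
    using insert.prems(1)[of d] subspace_neg[OF subspace_genspace[OF f]] by auto
  have "(\<Sum>c\<in>F. w c) = - w d"
    using insert.prems(2) insert.hyps by (simp add: eq_neg_iff_add_eq_0 add.commute)
  then have X: "- w d \<in> X" using insert.prems(1) unfolding X_def by (auto intro!: exI[of _ w])
  have inv: "f x - d *s x \<in> X" if "x \<in> X" for x
  proof -
    from that obtain u where u: "\<forall>c\<in>F. u c \<in> genspace f c" "x = (\<Sum>c\<in>F. u c)"
      by (auto simp: X_def)
    have "f x - d *s x = (\<Sum>c\<in>F. f (u c) - d *s u c)"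
      by (simp add: u(2) lin_sum[OF f] scale_sum_right sum_subtractf)
    then show ?thesis
      unfolding X_def using u(1) genspace_invariant_shift[OF f]
      by (auto intro!: exI[of _ "\<lambda>c. f (u c) - d *s u c"])
  qed
  have "w d = 0"
  proof (rule ccontr)
    assume "w d \<noteq> 0"
    then have "- w d \<notin> {0}" by simp
    from genspace_reduce[OF f subspace_single_0 wd X this inv]
    obtain v where v: "v \<in> X" "v \<noteq> 0" "f v - d *s v = 0" by auto
    from v(1) obtain u where u: "\<forall>c\<in>F. u c \<in> genspace f c" "v = (\<Sum>c\<in>F. u c)"
      by (auto simp: X_def)
    have "(\<Sum>c\<in>F. f (u c) - d *s u c) = 0"
      using v(3) by (simp add: u(2) lin_sum[OF f] scale_sum_right sum_subtractf)
    then have "f (u c) - d *s u c = 0" if "c \<in> F" for c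
      using insert.IH[of "\<lambda>c. f (u c) - d *s u c" c] that u(1) genspace_invariant_shift[OF f] by blast
    then have "u c = 0" if "c \<in> F" for c
      using genspace_shift_inj[OF f, of c d "u c"] that u(1) insert.hyps(2) by auto
    then show False using v(2) u(2) by simp
  qed
  moreover have "(\<Sum>c\<in>F. w c) = 0" using \<open>w d = 0\<close> insert.prems(2) insert.hyps by simp
  ultimately show ?case using insert.IH[of w c] insert.prems(1,3) by auto
qed simp

lemma basis_coordinates:
  assumes "independent B" "span B = UNIV"
  shows "finite B" "(\<Sum>b\<in>B. representation B v b *s b) = v"
  using assms finiteI_independent sum_representation_eq[of B v B] by auto

text \<open>A basis of generalized eigenvectors is scaled according to the eigenvalues. That
  \<open>t\<close> is correct on all of \<open>genspace f c\<close> follows from the uniqueness of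
  components. For the identity as \<sigma> this is the semisimple part of \<open>f\<close>; the
  application uses complex conjugation.\<close>

lemma semisimple_map_exists:
  assumes f: "lin f"
  shows "\<exists>t. lin t \<and> (\<forall>c. \<forall>v\<in>genspace f c. t v = \<sigma> c *s v)"
proof -
  obtain C where C: "C \<subseteq> (\<Union>c. genspace f c)" "independent C" "(\<Union>c. genspace f c) \<subseteq> span C"
    using maximal_independent_subset by blast
  then have span: "span C = UNIV" using span_genspaces[OF f] by (metis span_mono span_span top.extremum_uniqueI)
  note fin = basis_coordinates(1)[OF C(2) span]
  have "\<exists>l. \<forall>b\<in>C. b \<in> genspace f (l b)" using C(1) by (intro bchoice) auto
  then obtain l where l: "\<And>b. b \<in> C \<Longrightarrow> b \<in> genspace f (l b)" by blast
  obtain t where t: "lin t" "\<And>b. b \<in> C \<Longrightarrow> t b = \<sigma> (l b) *s b"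
    using pair.linear_independent_extend[OF C(2), of "\<lambda>b. \<sigma> (l b) *s b"] by blast
  have "t v = \<sigma> c *s v" if v: "v \<in> genspace f c" for c v
  proof -
    let ?r = "representation C v"
    \<comment> \<open>\<open>c\<close> is inserted because it may fail to label any basis vector;
      the comparison with \<open>v\<close> still needs a component at \<open>c\<close>.\<close>
    define F where "F = insert c (l ` C)"
    define w where "w e = (\<Sum>b\<in>{b\<in>C. l b = e}. ?r b *s b)" for e
    have F: "finite F" "l ` C \<subseteq> F" using fin by (auto simp: F_def)
    have wG: "w e \<in> genspace f e" for e
      unfolding w_def using l by (intro subspace_sum[OF subspace_genspace[OF f]] genspace_scale[OF f]) auto
    have sum: "(\<Sum>e\<in>F. w e) = v"
      unfolding w_def using sum.group[OF fin F, of "\<lambda>b. ?r b *s b"] basis_coordinates(2)[OF C(2) span] by simp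
    have "w e - (if e = c then v else 0) = 0" if "e \<in> F" for e
    proof (rule genspace_sum_zero[OF f F(1) _ _ that, of "\<lambda>e. w e - (if e = c then v else 0)"])
      show "w e - (if e = c then v else 0) \<in> genspace f e" for e
        using wG v subspace_diff[OF subspace_genspace[OF f]] genspace.zero by auto
      show "(\<Sum>e\<in>F. w e - (if e = c then v else 0)) = 0"
        using F(1) sum by (simp add: sum_subtractf sum.delta') (simp add: F_def)
    qed
    then have we: "w e = (if e = c then v else 0)" if "e \<in> F" for e
      using that by auto
    have "t v = (\<Sum>b\<in>C. t (?r b *s b))"
      using lin_sum[OF t(1), of "\<lambda>b. ?r b *s b" C] basis_coordinates(2)[OF C(2) span, of v] by simp
    also have "\<dots> = (\<Sum>b\<in>C. ?r b *s (\<sigma> (l b) *s b))"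
      by (intro sum.cong refl) (simp only: lin_scale[OF t(1)] t(2))
    also have "\<dots> = (\<Sum>e\<in>F. \<Sum>b\<in>{b\<in>C. l b = e}. ?r b *s (\<sigma> (l b) *s b))"
      by (rule sum.group[OF fin F, symmetric])
    also have "\<dots> = (\<Sum>e\<in>F. \<sigma> e *s w e)"
      unfolding w_def by (intro sum.cong refl) (auto simp: scale_sum_right mult.commute intro!: sum.cong)
    also have "\<dots> = (\<Sum>e\<in>F. if e = c then \<sigma> c *s v else 0)"
      using we by (intro sum.cong) auto
    also have "\<dots> = \<sigma> c *s v" using F(1) by (simp add: F_def)
    finally show ?thesis .
  qed
  with t(1) show ?thesis by blast
qed

section \<open>The trace and triangular bases\<close>

definition tr :: "('a \<Rightarrow> 'a) \<Rightarrow> complex" where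
  "tr f = (\<Sum>b\<in>Basis. representation Basis (f b) b)"

lemma trace_swap:
  assumes B: "independent B" "span B = UNIV" and C: "independent C" "span C = UNIV"
    and f: "lin f" and g: "lin g"
  shows "(\<Sum>b\<in>B. representation B (f (g b)) b) = (\<Sum>c\<in>C. representation C (g (f c)) c)"
proof -
  have expand: "representation E (h v) e = (\<Sum>d\<in>D. representation D v d * representation E (h d) e)"
    if D: "independent D" "span D = UNIV" and E: "independent E" "span E = UNIV" and h: "lin h"
    for D E h v e
  proof -
    have "h v = (\<Sum>d\<in>D. representation D v d *s h d)"
      using lin_sum[OF h, of "\<lambda>d. representation D v d *s d" D] basis_coordinates(2)[OF D, of v]
      by (simp add: lin_scale[OF h])
    show ?thesis
      unfolding \<open>h v = _\<close> by (simp only: representation_sum[OF E(1)] representation_scale[OF E(1)] E(2) UNIV_I)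
  qed
  have "(\<Sum>b\<in>B. representation B (f (g b)) b) =
      (\<Sum>b\<in>B. \<Sum>c\<in>C. representation C (g b) c * representation B (f c) b)"
    by (intro sum.cong refl expand[OF C B f])
  also have "\<dots> = (\<Sum>c\<in>C. \<Sum>b\<in>B. representation B (f c) b * representation C (g b) c)"
    by (subst sum.swap) (intro sum.cong refl mult.commute)
  also have "\<dots> = (\<Sum>c\<in>C. representation C (g (f c)) c)"
    by (intro sum.cong refl expand[OF B C g, symmetric])
  finally show ?thesis .
qed

lemma tr_basis:
  assumes "independent B" "span B = UNIV" "lin f"
  shows "(\<Sum>b\<in>B. representation B (f b) b) = tr f"
  unfolding tr_def
  using trace_swap[OF assms(1,2) independent_Basis span_Basis assms(3) linear_ident] .

lemma tr_commute: "lin f \<Longrightarrow> lin g \<Longrightarrow> tr (\<lambda>x. f (g x)) = tr (\<lambda>x. g (f x))"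
  unfolding tr_def using trace_swap[OF independent_Basis span_Basis independent_Basis span_Basis] .

lemma tr_add: "tr (\<lambda>x. f x + g x) = tr f + tr g"
  by (simp add: tr_def representation_add independent_Basis span_Basis sum.distrib)

lemma tr_diff: "tr (\<lambda>x. f x - g x) = tr f - tr g"
  by (simp add: tr_def representation_diff independent_Basis span_Basis sum_subtractf)

lemma tr_scale: "tr (\<lambda>x. c *s f x) = c * tr f"
  by (simp add: tr_def representation_scale independent_Basis span_Basis sum_distrib_left)

lemma tr_zero: "tr (\<lambda>x. 0) = 0"
  by (simp add: tr_def representation_zero)

text \<open>A basis in which \<open>f\<close> is triangular with diagonal entries \<open>c\<close>.
  The vectors are also generalized eigenvectors, so a map that is scalar on each
  \<open>genspace f c\<close> is diagonal in the same basis.\<close>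

inductive flag :: "('a \<Rightarrow> 'a) \<Rightarrow> 'a set \<Rightarrow> bool" for f where
  empty: "flag f {}"
| insert: "flag f B \<Longrightarrow> v \<in> genspace f c \<Longrightarrow> v \<notin> span B \<Longrightarrow> f v - c *s v \<in> span B \<Longrightarrow>
    flag f (insert v B)"

lemma flag_independent: "flag f B \<Longrightarrow> independent B"
  by (induction rule: flag.induct) (simp_all only: independent_empty independent_insertI not_False_eq_True)

text \<open>If a flag of greatest size did not span, some generalized eigenspace would leave its
  span, and \<open>genspace_reduce\<close> would supply a vector to add.\<close>

lemma flag_exists:
  assumes f: "lin f"
  shows "\<exists>B. flag f B \<and> span B = UNIV"
proof -
  have "\<forall>B. flag f B \<longrightarrow> card B < Suc dimension"
    using independent_card_le_dim[OF subset_UNIV] flag_independent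
    by (auto simp: dimension_def less_Suc_eq_le)
  then obtain B where B: "flag f B" "\<And>C. flag f C \<Longrightarrow> card C \<le> card B"
    using ex_has_greatest_nat[of "flag f" "{}" card "Suc dimension"] flag.empty by (metis less_or_eq_imp_le)
  have "span B = UNIV"
  proof (rule ccontr)
    assume "span B \<noteq> UNIV"
    then have "\<not> (\<Union>c. genspace f c) \<subseteq> span B"
      using span_genspaces[OF f] by (metis span_mono span_span top.extremum_uniqueI)
    then obtain x c where x: "x \<in> genspace f c" "x \<notin> span B" by blast
    from genspace_reduce[OF f subspace_span x(1) UNIV_I x(2)]
    obtain v where v: "v \<in> genspace f c" "v \<notin> span B" "f v - c *s v \<in> span B" by auto
    then have "v \<notin> B" using span_base by blast
    moreover have "finite B" using B(1) flag_independent finiteI_independent by blast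
    ultimately show False using B(2)[OF flag.insert[OF B(1) v]] by simp
  qed
  with B(1) show ?thesis by blast
qed

text \<open>The diagonal entries of \<open>f\<close> and \<open>t\<close> are \<open>c\<close> and
  \<open>cnj c\<close>, so the trace of the product is the sum of the \<open>|c|\<^sup>2\<close>,
  which vanishes only if all \<open>c\<close> do. The invariance of \<open>span B\<close> is carried
  along because it keeps the old coefficients unchanged when the basis grows.\<close>

lemma flag_trace:
  assumes f: "lin f" and t: "lin t" "\<And>c v. v \<in> genspace f c \<Longrightarrow> t v = cnj c *s v"
  shows "flag f B \<Longrightarrow> (\<forall>b\<in>B. f (t b) \<in> span B) \<and>
    (\<exists>\<rho>\<ge>0. (\<Sum>b\<in>B. representation B (f (t b)) b) = of_real \<rho> \<and> (\<rho> = 0 \<longrightarrow> B \<subseteq> genspace f 0))"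
proof (induction rule: flag.induct)
  case empty
  then show ?case by (auto intro!: exI[of _ 0])
next
  case (insert B v c)
  then obtain \<rho> where inv: "\<forall>b\<in>B. f (t b) \<in> span B" and \<rho>: "\<rho> \<ge> 0"
    "(\<Sum>b\<in>B. representation B (f (t b)) b) = of_real \<rho>" "\<rho> = 0 \<longrightarrow> B \<subseteq> genspace f 0"
    by blast
  let ?B = "insert v B"
  define w where "w = f v - c *s v"
  have ind: "independent ?B" "independent B"
    using flag_independent flag.insert[OF insert.hyps] insert.hyps(1) by blast+
  have w: "w \<in> span B" using insert.hyps by (simp add: w_def)
  have vB: "v \<notin> B" using insert.hyps span_base by blast
  have "t v = cnj c *s v" using t(2) insert.hyps(2) by blast
  moreover have "f v = c *s v + w" by (simp add: w_def)
  ultimately have ftv: "f (t v) = (cnj c * c) *s v + cnj c *s w"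
    using lin_scale[OF f] by (simp add: scale_right_distrib)
  have sub: "span B \<subseteq> span ?B" by (intro span_mono) auto
  have vs: "v \<in> span ?B" by (intro span_base) auto
  have 1: "f (t v) \<in> span ?B" unfolding ftv using w sub vs by (intro span_add span_scale) auto
  have "representation ?B (f (t v)) v = cnj c * c * representation ?B v v + cnj c * representation ?B w v"
    unfolding ftv using ind w sub vs by (subst representation_add) (auto simp: representation_scale span_scale)
  also have "representation ?B w v = 0"
    using representation_extend[OF ind(1) w subset_insertI] representation_ne_zero[of B w v] vB by metis
  also have "representation ?B v v = 1" using ind by (simp add: representation_basis)
  finally have 2: "representation ?B (f (t v)) v = of_real ((cmod c)\<^sup>2)"
    by (simp only: complex_norm_square mult.commute) simp
  have "(\<Sum>b\<in>B. representation ?B (f (t b)) b) = of_real \<rho>"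
    unfolding \<rho>(2)[symmetric] using representation_extend[OF ind(1)] inv
    by (intro sum.cong refl) (metis subset_insertI)
  with 2 have "(\<Sum>b\<in>?B. representation ?B (f (t b)) b) = of_real ((cmod c)\<^sup>2 + \<rho>)"
    using vB finiteI_independent[OF ind(2)] by simp
  moreover have "(cmod c)\<^sup>2 + \<rho> = 0 \<longrightarrow> ?B \<subseteq> genspace f 0"
    using \<rho> insert.hyps(2) by (auto simp: add_nonneg_eq_0_iff)
  ultimately show ?case using 1 inv sub \<rho>(1) by (auto intro!: exI[of _ "(cmod c)\<^sup>2 + \<rho>"])
qed

lemma nilpotent_if_trace_zero:
  assumes f: "lin f" and t: "lin t" "\<And>c v. v \<in> genspace f c \<Longrightarrow> t v = cnj c *s v"
    and zero: "tr (\<lambda>x. f (t x)) = 0"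
  shows "v \<in> genspace f 0"
proof -
  obtain B where B: "flag f B" "span B = UNIV" using flag_exists[OF f] by blast
  have "lin (\<lambda>x. f (t x))" by (rule lin_comp[OF f t(1)])
  then have "(\<Sum>b\<in>B. representation B (f (t b)) b) = 0"
    using tr_basis[OF flag_independent[OF B(1)] B(2)] zero by simp
  then have "B \<subseteq> genspace f 0" using flag_trace[OF f t B(1)] by auto
  then show ?thesis using B(2) span_minimal[OF _ subspace_genspace[OF f]] by blast
qed

end

section \<open>The Killing form and inner derivations\<close>

text \<open>Instead of a Lie algebra on the carrier \<open>S\<close> we use the direct sum of \<open>S\<close> and a central
  complement, with \<open>P\<close> the projection onto \<open>S\<close>; then all maps are linear on the whole type.\<close>

locale split_lie = complex_fd scale Basis
  for scale :: "complex \<Rightarrow> 'a::ab_group_add \<Rightarrow> 'a" (infixr \<open>*s\<close> 75) and Basis +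
  fixes b :: "'a \<Rightarrow> 'a \<Rightarrow> 'a" and P :: "'a \<Rightarrow> 'a"
  assumes lin_left: "lin (\<lambda>x. b x y)"
    and lin_right: "lin (b x)"
    and alternating: "b x x = 0"
    and jacobi: "b (b x y) z = b (b x z) y + b x (b y z)"
    and lin_P: "lin P"
    and P_P: "P (P x) = P x"
    and central: "P y = 0 \<Longrightarrow> b x y = 0"
    and ideal_trivial: "subspace J \<Longrightarrow> (\<And>x y. x \<in> J \<Longrightarrow> b x y \<in> J) \<Longrightarrow>
      (\<And>x y. x \<in> J \<Longrightarrow> y \<in> J \<Longrightarrow> P (b x y) = 0) \<Longrightarrow> x \<in> J \<Longrightarrow> P x = 0"
begin

lemmas add_left = lin_add[OF lin_left]
  and scale_left = lin_scale[OF lin_left]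
  and diff_left = lin_diff[OF lin_left]
  and zero_left = lin_zero[OF lin_left]
  and add_right = lin_add[OF lin_right]
  and scale_right = lin_scale[OF lin_right]
  and diff_right = lin_diff[OF lin_right]
  and zero_right = lin_zero[OF lin_right]

lemma antisym: "b x y = - b y x"
proof -
  have "b (x + y) (x + y) = b x y + b y x"
    unfolding add_left add_right by (simp add: alternating)
  then show ?thesis by (simp add: alternating eq_neg_iff_add_eq_0)
qed

section \<open>Derivations and the invariance of the Killing form\<close>

definition derivation :: "('a \<Rightarrow> 'a) \<Rightarrow> bool" where
  "derivation d \<longleftrightarrow> lin d \<and> (\<forall>x y. d (b x y) = b (d x) y + b x (d y))"

lemma derivation_ad: "derivation (\<lambda>x. b x a)"
  unfolding derivation_def using lin_left jacobi by blast

definition killing :: "'a \<Rightarrow> 'a \<Rightarrow> complex" where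
  "killing x y = tr (\<lambda>z. b (b z x) y)"

lemma killing_sym: "killing x y = killing y x"
  unfolding killing_def by (rule tr_commute[OF lin_left lin_left])

lemma killing_add: "killing x (y + z) = killing x y + killing x z"
  by (simp only: killing_def add_right tr_add)

lemma killing_scale: "killing x (c *s y) = c * killing x y"
  by (simp only: killing_def scale_right tr_scale)

lemma killing_zero: "killing x 0 = 0"
  by (simp only: killing_def zero_right tr_zero)

text \<open>Substitute \<open>[z, d x] = d [z, x] - [d z, x]\<close> and move \<open>d\<close>
  around the trace. For an inner derivation this is the usual invariance of the form.\<close>

lemma killing_derivation:
  assumes "derivation d"
  shows "killing (d x) y = - killing x (d y)"
proof -
  have d: "lin d" "\<And>x y. d (b x y) = b (d x) y + b x (d y)"
    using assms by (auto simp: derivation_def)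
  have "killing (d x) y = tr (\<lambda>z. b (d (b z x)) y - b (b (d z) x) y)"
    unfolding killing_def by (simp add: d(2) add_left)
  also have "\<dots> = tr (\<lambda>z. b (d (b z x)) y) - tr (\<lambda>z. b (b (d z) x) y)"
    by (rule tr_diff)
  also have "tr (\<lambda>z. b (b (d z) x) y) = tr (\<lambda>z. d (b (b z x) y))"
    by (rule tr_commute[OF lin_comp[OF lin_left lin_left] d(1)])
  also have "\<dots> = tr (\<lambda>z. b (d (b z x)) y) + tr (\<lambda>z. b (b z x) (d y))"
    by (simp only: d(2)[of "b _ _"] tr_add)
  finally show ?thesis by (simp add: killing_def)
qed

definition killing_radical :: "'a set" where
  "killing_radical = {x. \<forall>y. killing x y = 0}"

lemma subspace_killing_radical: "subspace killing_radical"
  unfolding killing_radical_def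
  by (rule subspaceI) (auto simp: killing_sym[of _ y for y] killing_add killing_scale killing_zero)

lemma killing_radical_ideal: "x \<in> killing_radical \<Longrightarrow> b x y \<in> killing_radical"
  unfolding killing_radical_def using killing_derivation[OF derivation_ad] by simp

text \<open>The identity \<open>(f - (c + d)) [x, y] = [(f - c) x, y] + [x, (f - d) y]\<close>
  lowers one argument at a time, hence the induction on \<open>y\<close> inside the one on
  \<open>x\<close>.\<close>

lemma genspace_bracket:
  assumes "derivation f"
  shows "x \<in> genspace f c \<Longrightarrow> y \<in> genspace f d \<Longrightarrow> b x y \<in> genspace f (c + d)"
proof (induction arbitrary: y rule: genspace.induct)
  case zero
  then show ?case by (simp add: zero_left genspace.zero)
next
  case (step x)
  have f: "lin f" "\<And>x y. f (b x y) = b (f x) y + b x (f y)"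
    using assms by (auto simp: derivation_def)
  from step.prems show ?case
  proof (induction rule: genspace.induct)
    case zero
    then show ?case by (simp add: zero_right genspace.zero)
  next
    case (step y)
    have "y \<in> genspace f d" using step.hyps by (rule genspace.step)
    then have "b (f x - c *s x) y + b x (f y - d *s y) \<in> genspace f (c + d)"
      using \<open>\<And>y. y \<in> genspace f d \<Longrightarrow> b (f x - c *s x) y \<in> genspace f (c + d)\<close> step.IH
        genspace_add[OF f(1)] by blast
    then show ?case
      by (rule genspace_stepI[rotated])
        (simp add: f(2) diff_left diff_right scale_left scale_right scale_left_distrib)
  qed
qed

text \<open>Eigenvalues add under the bracket, so an additive \<sigma> gives the product rule on
  generalized eigenvectors; these span, and bilinearity extends the rule in one argument after the
  other.\<close>

lemma derivation_eigenvalue_additive: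
  assumes f: "derivation f" and t: "lin t" "\<And>c v. v \<in> genspace f c \<Longrightarrow> t v = \<sigma> c *s v"
    and \<sigma>: "\<And>c d. \<sigma> (c + d) = \<sigma> c + \<sigma> d"
  shows "derivation t"
proof -
  let ?G = "\<Union>c. genspace f c"
  have span: "span ?G = UNIV" using f span_genspaces by (simp add: derivation_def)
  have "t (b x y) = b (t x) y + b x (t y)" for x y
  proof -
    have 1: "t (b x y) = b (t x) y + b x (t y)" if x: "x \<in> ?G" for x y
    proof (rule pair.linear_eq_on[of "\<lambda>y. t (b x y)" "\<lambda>y. b (t x) y + b x (t y)" y ?G])
      show "lin (\<lambda>y. t (b x y))" by (rule lin_comp[OF t(1) lin_right])
      show "lin (\<lambda>y. b (t x) y + b x (t y))"
        by (rule pair.linear_compose_add[OF lin_right lin_comp[OF lin_right t(1)]])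
      show "y \<in> span ?G" by (simp add: span)
      fix z assume "z \<in> ?G"
      with x obtain c d where "x \<in> genspace f c" "z \<in> genspace f d" by blast
      then show "t (b x z) = b (t x) z + b x (t z)"
        using genspace_bracket[OF f, of x c z d] t(2)
        by (simp add: \<sigma> scale_left scale_right scale_left_distrib)
    qed
    show ?thesis
    proof (rule pair.linear_eq_on[of "\<lambda>x. t (b x y)" "\<lambda>x. b (t x) y + b x (t y)" x ?G])
      show "lin (\<lambda>x. t (b x y))" by (rule lin_comp[OF t(1) lin_left])
      show "lin (\<lambda>x. b (t x) y + b x (t y))"
        by (rule pair.linear_compose_add[OF lin_comp[OF lin_left t(1)] lin_left])
      show "x \<in> span ?G" by (simp add: span)
    qed (rule 1)
  qed
  then show ?thesis using t(1) by (simp add: derivation_def)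
qed

section \<open>The Killing radical: Cartan's criterion and Engel's theorem\<close>

definition radical_derived :: "'a set" where
  "radical_derived = span {b x y | x y. x \<in> killing_radical \<and> y \<in> killing_radical}"

text \<open>For \<open>x = [y, z]\<close> the Jacobi identity splits the trace into two terms which
  cancel, by cyclicity, up to \<open>killing (t y) z\<close>; this is \<open>0\<close> since
  \<open>z\<close> is in the radical. The derivation \<open>t\<close> is arbitrary because it will
  be a conjugated semisimple part, which is not known to be inner.\<close>

lemma radical_derived_trace:
  assumes t: "derivation t" and x: "x \<in> radical_derived"
  shows "tr (\<lambda>w. b (t w) x) = 0"
  using x unfolding radical_derived_def
proof (induction rule: span_induct)
  case base
  show ?case
    by (auto intro!: subspaceI simp: add_right scale_right zero_right tr_add tr_scale tr_zero)
next
  case (step x)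
  then obtain y z where yz: "y \<in> killing_radical" "z \<in> killing_radical" "x = b y z" by blast
  have l: "lin t" and d: "\<And>x y. t (b x y) = b (t x) y + b x (t y)"
    using t by (auto simp: derivation_def)
  have jac: "b w (b y z) = b (b w y) z - b (b w z) y" for w by (simp add: jacobi[of w y z])
  have "tr (\<lambda>w. b (t w) x) = tr (\<lambda>w. b (b (t w) y) z) - tr (\<lambda>w. b (b (t w) z) y)"
    unfolding yz jac by (rule tr_diff)
  also have "tr (\<lambda>w. b (b (t w) y) z) = tr (\<lambda>w. b (t (b w y)) z - b (b w (t y)) z)"
    by (simp add: d add_left)
  also have "\<dots> = tr (\<lambda>w. b (t (b w y)) z) - killing (t y) z"
    by (simp only: tr_diff killing_def)
  also have "killing (t y) z = 0"
    using yz(2) by (subst killing_sym) (simp add: killing_radical_def)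
  also have "tr (\<lambda>w. b (t (b w y)) z) = tr (\<lambda>w. b (b (t w) z) y)"
    by (rule tr_commute[OF lin_comp[OF lin_left l] lin_left])
  finally show ?case by simp
qed

text \<open>Complex conjugation turns the eigenvalues \<open>c\<close> of \<open>ad x\<close> into those of a derivation \<open>t\<close>,
  and \<open>tr (ad x \<circ> t) = 0\<close> becomes \<open>\<Sum> |c|\<^sup>2 = 0\<close>. This replaces the rational linear
  functionals of the usual proof of Cartan's criterion.\<close>

lemma radical_derived_nilpotent:
  assumes x: "x \<in> radical_derived"
  shows "v \<in> genspace (\<lambda>w. b w x) 0"
proof -
  obtain t where t: "lin t" "\<And>c v. v \<in> genspace (\<lambda>w. b w x) c \<Longrightarrow> t v = cnj c *s v"
    using semisimple_map_exists[OF lin_left[of x], of cnj] by blast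
  have "derivation t"
    by (rule derivation_eigenvalue_additive[OF derivation_ad t]) auto
  then show ?thesis
    using nilpotent_if_trace_zero[OF lin_left t] radical_derived_trace x by blast
qed

text \<open>\<open>K\<close> acts on the quotient of \<open>U\<close> by \<open>W\<close>. Leaving
  \<open>U\<close> and \<open>W\<close> free lets the induction hypothesis for a maximal proper
  subalgebra \<open>M\<close> serve twice: on \<open>K\<close> modulo \<open>M\<close> it gives a
  \<open>y\<close> that normalizes \<open>M\<close>, and on \<open>U\<close> modulo \<open>W\<close>
  a vector annihilated by \<open>M\<close>.\<close>

theorem engel:
  assumes "subspace K" "\<And>x y. x \<in> K \<Longrightarrow> y \<in> K \<Longrightarrow> b x y \<in> K"
    and "\<And>x v. x \<in> K \<Longrightarrow> v \<in> genspace (\<lambda>w. b w x) 0"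
    and "subspace U" "\<And>u x. u \<in> U \<Longrightarrow> x \<in> K \<Longrightarrow> b u x \<in> U"
    and "subspace W" "\<And>w x. w \<in> W \<Longrightarrow> x \<in> K \<Longrightarrow> b w x \<in> W"
    and "W \<subset> U"
  shows "\<exists>u\<in>U. u \<notin> W \<and> (\<forall>x\<in>K. b u x \<in> W)"
  using assms
proof (induction "dim K" arbitrary: K U W rule: less_induct)
  case less
  note K = less.prems(1-3) and U = less.prems(4,5) and W = less.prems(6,7)
  show ?case
  proof (cases "K = {0}")
    case True
    then show ?thesis using less.prems(8) subspace_0[OF W(1)] by (auto simp: zero_right)
  next
    case False
    define Q where "Q M \<longleftrightarrow> subspace M \<and> (\<forall>x\<in>M. \<forall>y\<in>M. b x y \<in> M) \<and> M \<subset> K" for M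
    have Q0: "Q {0}" using False subspace_0[OF K(1)] by (auto simp: Q_def zero_right)
    have bound: "\<forall>M. Q M \<longrightarrow> dim M < Suc (dim K)" using dim_subset by (auto simp: Q_def less_Suc_eq_le)
    from ex_has_greatest_nat[of Q, OF Q0 bound]
    obtain M where QM: "Q M" and max: "\<And>N. Q N \<Longrightarrow> dim N \<le> dim M" by blast
    have M: "subspace M \<and> (\<forall>x\<in>M. \<forall>y\<in>M. b x y \<in> M) \<and> M \<subset> K" using QM by (simp add: Q_def)
    have strict: "dim N < dim N'" if "subspace N" "subspace N'" "N \<subset> N'" for N N'
      using that dim_psubset[of N N'] by (metis span_eq_iff)
    have MK: "dim M < dim K" using strict M K(1) by blast
    have "\<exists>y\<in>K. y \<notin> M \<and> (\<forall>x\<in>M. b y x \<in> M)"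
      using M K by (intro less.hyps[OF MK]) auto
    then obtain y where y: "y \<in> K" "y \<notin> M" "\<And>x. x \<in> M \<Longrightarrow> b y x \<in> M" by blast
    have M_span: "x \<in> span (insert y M) \<longleftrightarrow> (\<exists>c. x - c *s y \<in> M)" for x
      using M by (simp add: span_breakdown_eq span_eq_iff[THEN iffD2])
    \<comment> \<open>As \<open>y\<close> normalizes \<open>M\<close>, adjoining it gives a
      subalgebra strictly larger than \<open>M\<close>, and maximality leaves only
      \<open>K\<close>.\<close>
    have "span (insert y M) = K"
    proof (rule ccontr)
      assume ne: "span (insert y M) \<noteq> K"
      have "b x z \<in> M" if "x \<in> span (insert y M)" "z \<in> span (insert y M)" for x z
      proof -
        from that obtain c d where cd: "x - c *s y \<in> M" "z - d *s y \<in> M" using M_span by blast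
        define x' z' where "x' = x - c *s y" and "z' = z - d *s y"
        have xz: "x = x' + c *s y" "z = z' + d *s y" "x' \<in> M" "z' \<in> M"
          using cd by (auto simp: x'_def z'_def)
        have "b x z = b x' z' + c *s b y z' - d *s b y x'"
          unfolding xz(1,2) using antisym[of x' y]
          by (simp add: add_left add_right scale_left scale_right alternating)
        then show ?thesis
          using xz M y(3) by (auto intro!: subspace_add subspace_diff subspace_scale)
      qed
      moreover have "M \<subseteq> span (insert y M)" "y \<in> span (insert y M)"
        by (auto intro: span_base)
      moreover have "span (insert y M) \<subseteq> K" using M y(1) by (intro span_minimal[OF _ K(1)]) auto
      ultimately have "Q (span (insert y M))" using ne by (auto simp: Q_def)
      moreover have "dim M < dim (span (insert y M))"
        using \<open>M \<subseteq> span (insert y M)\<close> \<open>y \<in> span (insert y M)\<close> y(2) M by (intro strict) auto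
      ultimately show False using max[of "span (insert y M)"] by linarith
    qed
    have "\<exists>u\<in>U. u \<notin> W \<and> (\<forall>x\<in>M. b u x \<in> W)"
      using M K U W less.prems(8) by (intro less.hyps[OF MK]) auto
    then obtain u where u: "u \<in> U" "u \<notin> W" "\<forall>x\<in>M. b u x \<in> W" by blast
    \<comment> \<open>The vectors annihilated by \<open>M\<close> modulo \<open>W\<close>.
      Bracketing with \<open>y\<close> preserves them because \<open>[y, M] \<subseteq> M\<close>,
      and it is nilpotent, so the last iterate outside \<open>W\<close> is annihilated by
      \<open>y\<close> as well. The term \<open>0 *s v\<close> below only matches the form of
      \<open>genspace_reduce\<close>.\<close>
    define U' where "U' = {u \<in> U. \<forall>x\<in>M. b u x \<in> W}"
    have "b v y - 0 *s v \<in> U'" if "v \<in> U'" for v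
    proof -
      have "b (b v y) x \<in> W" if "x \<in> M" for x
        using \<open>v \<in> U'\<close> that y W by (simp add: jacobi[of v y x] U'_def subspace_add)
      then show ?thesis using that U(2) y(1) by (simp add: U'_def)
    qed
    moreover have "u \<in> U'" using u by (simp add: U'_def)
    ultimately obtain v where v: "v \<in> U'" "v \<notin> W" "b v y \<in> W"
      using genspace_reduce[OF lin_left W(1) K(3)[OF y(1), of u], of U'] u(2) by auto
    have "b v x \<in> W" if "x \<in> K" for x
    proof -
      from that obtain c where c: "x - c *s y \<in> M"
        using M_span \<open>span (insert y M) = K\<close> by blast
      have "b v (x - c *s y) + c *s b v y \<in> W"
        using v c by (intro subspace_add[OF W(1)] subspace_scale[OF W(1)]) (auto simp: U'_def)
      then show ?thesis by (simp add: diff_right scale_right)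
    qed
    then show ?thesis using v by (auto simp: U'_def)
  qed
qed

lemma radical_derived_ideal:
  assumes "x \<in> radical_derived" shows "b x y \<in> radical_derived"
  using assms unfolding radical_derived_def
proof (induction rule: span_induct)
  case base
  show ?case
    by (auto intro!: subspaceI simp: add_left scale_left zero_left intro: span_add span_scale span_zero)
next
  case (step x)
  then obtain u v where uv: "u \<in> killing_radical" "v \<in> killing_radical" "x = b u v" by blast
  from uv(3) have "b x y = b (b u y) v + b u (b v y)" by (simp only: jacobi[of u v y])
  moreover have "b u y \<in> killing_radical" "b v y \<in> killing_radical"
    using uv killing_radical_ideal by auto
  ultimately show ?case using uv by (auto intro!: span_add intro: span_base)
qed

text \<open>Otherwise Engel's theorem, for \<open>radical_derived\<close> acting on itself modulo
  the kernel of \<open>P\<close>, gives an element outside the kernel that is central modulo it. All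
  such central elements form an ideal \<open>J\<close> that is abelian modulo the kernel,
  contradicting \<open>ideal_trivial\<close>.\<close>

lemma radical_derived_central:
  assumes "x \<in> radical_derived" shows "P x = 0"
proof (rule ccontr)
  assume "P x \<noteq> 0"
  let ?N = radical_derived
  let ?W = "?N \<inter> {x. P x = 0}"
  have N: "subspace ?N" by (simp add: radical_derived_def)
  have W: "subspace ?W" by (rule subspace_inter[OF N pair.linear_subspace_kernel[OF lin_P]])
  have left: "P x = 0 \<Longrightarrow> b x y = 0" for x y using central[of x y] antisym[of x y] by simp
  have "\<exists>u\<in>?N. u \<notin> ?W \<and> (\<forall>x\<in>?N. b u x \<in> ?W)"
    using radical_derived_ideal radical_derived_nilpotent \<open>P x \<noteq> 0\<close> assms left
    by (intro engel[OF N _ _ N _ W]) (auto simp: zero_left subspace_0[OF N] lin_zero[OF lin_P])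
  then obtain u where u: "u \<in> ?N" "P u \<noteq> 0" "\<forall>x\<in>?N. P (b u x) = 0" by blast
  define J where "J = {u \<in> ?N. \<forall>x\<in>?N. P (b u x) = 0}"
  have "subspace J"
    using N by (auto simp: J_def subspace_0 subspace_add subspace_scale add_left scale_left zero_left
        lin_add[OF lin_P] lin_scale[OF lin_P] lin_zero[OF lin_P] intro!: subspaceI)
  moreover have "b v y \<in> J" if "v \<in> J" for v y
  proof -
    have "P (b (b v y) x) = 0" if "x \<in> ?N" for x
    proof -
      have "b (b v y) x = b v (b y x)"
        using \<open>v \<in> J\<close> that left by (simp add: jacobi[of v y x] J_def)
      moreover have "b y x \<in> ?N"
        using radical_derived_ideal[OF that, of y] antisym[of y x] subspace_neg[OF N] by simp
      ultimately show ?thesis using \<open>v \<in> J\<close> by (simp add: J_def)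
    qed
    then show ?thesis using that radical_derived_ideal by (auto simp: J_def)
  qed
  ultimately have "P u = 0" using u by (intro ideal_trivial[of J u]) (auto simp: J_def)
  with u(2) show False by blast
qed

text \<open>By the preceding lemma the radical is itself abelian modulo the kernel of
  \<open>P\<close>, so \<open>ideal_trivial\<close> applies to it. In other words, the form is
  nondegenerate on the range of \<open>P\<close>.\<close>

theorem killing_radical_central:
  assumes "x \<in> killing_radical" shows "P x = 0"
proof (rule ideal_trivial[OF subspace_killing_radical _ _ assms])
  show "P (b x y) = 0" if "x \<in> killing_radical" "y \<in> killing_radical" for x y
    using that by (intro radical_derived_central) (auto simp: radical_derived_def intro: span_base)
qed (rule killing_radical_ideal)

section \<open>Representation of functionals and inner derivations\<close>

lemma bracket_P: "b x (P y) = b x y"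
proof -
  have "P (y - P y) = 0" by (simp add: lin_diff[OF lin_P] P_P)
  then have "b x (y - P y) = 0" by (rule central)
  then show ?thesis by (simp add: diff_right)
qed

lemma killing_P: "killing x (P y) = killing x y"
  by (simp only: killing_def bracket_P)

text \<open>Nondegeneracy makes \<open>x \<mapsto> killing x\<close> injective on the range of
  \<open>P\<close>, and a dimension count makes it onto the functionals that factor through
  \<open>P\<close>.\<close>

lemma killing_represents:
  assumes g: "\<And>x y. g (x + y) = g x + g y" "\<And>c x. g (c *s x) = c * g x" "\<And>y. g (P y) = g y"
  shows "\<exists>a. \<forall>y. killing a y = g y"
proof -
  obtain B where B: "B \<subseteq> range P" "independent B" "range P \<subseteq> span B"
    using maximal_independent_subset by blast
  have fin: "finite B" using B(2) by (rule finiteI_independent)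
  have PB: "P e = e" if "e \<in> B" for e using that B(1) P_P by auto
  have eqI: "h y = h' y" if "\<And>e. e \<in> B \<Longrightarrow> h e = h' e"
    and h: "\<And>x y. h (x + y) = h x + h y" "\<And>c x. h (c *s x) = c * h x" "\<And>y. h (P y) = h y"
    and h': "\<And>x y. h' (x + y) = h' x + h' y" "\<And>c x. h' (c *s x) = c * h' x" "\<And>y. h' (P y) = h' y"
    for h h' :: "'a \<Rightarrow> complex" and y
  proof -
    have "h x = h' x" if "x \<in> span B" for x
      using that
    proof (induction rule: span_induct_alt)
      case base
      show ?case using h(2)[of 0 0] h'(2)[of 0 0] by simp
    next
      case (step c x y)
      then show ?case using \<open>\<And>e. e \<in> B \<Longrightarrow> h e = h' e\<close> by (simp add: h(1,2) h'(1,2))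
    qed
    from this[of "P y"] B(3) show ?thesis by (auto simp: h(3) h'(3))
  qed
  \<comment> \<open>The sum records the values of \<open>killing x\<close> on the basis
    \<open>B\<close>. The term \<open>x - P x\<close> completes it to an injective endomorphism of
    the whole space, where injectivity implies surjectivity.\<close>
  define T where "T x = (\<Sum>e\<in>B. killing x e *s e) + (x - P x)" for x
  have PT: "P (T x) = (\<Sum>e\<in>B. killing x e *s e)" for x
    by (simp add: T_def lin_add[OF lin_P] lin_diff[OF lin_P] lin_sum[OF lin_P] lin_scale[OF lin_P] PB P_P)
  have "lin T"
    by (simp add: T_def lin_iff killing_sym[of _ e for e] killing_add killing_scale lin_add[OF lin_P]
      lin_scale[OF lin_P] scale_left_distrib sum.distrib scale_sum_right scale_right_distrib
      scale_right_diff_distrib algebra_simps)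
  moreover have "inj T"
    unfolding pair.linear_inj_iff_eq_0[OF \<open>lin T\<close>]
  proof (intro allI impI)
    fix x assume "T x = 0"
    then have sum: "(\<Sum>e\<in>B. killing x e *s e) = 0" using PT[of x] by (simp add: lin_zero[OF lin_P])
    have "killing x e = 0" if "e \<in> B" for e
      by (rule independentD[OF B(2) fin subset_refl sum that])
    then have "killing x y = 0" for y
      using eqI[of "killing x" "\<lambda>_. 0" y] by (simp add: killing_add killing_scale killing_P)
    then have "P x = 0" using killing_radical_central by (simp add: killing_radical_def)
    with \<open>T x = 0\<close> sum show "x = 0" by (simp add: T_def)
  qed
  ultimately have "surj T" by (rule linear_inj_imp_surj)
  then obtain a where a: "T a = (\<Sum>e\<in>B. g e *s e)" by (metis surjD)
  then have "(\<Sum>e\<in>B. killing a e *s e) = (\<Sum>e\<in>B. g e *s e)"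
    using PT[of a] by (simp add: lin_sum[OF lin_P] lin_scale[OF lin_P] PB)
  then have 0: "(\<Sum>e\<in>B. (killing a e - g e) *s e) = 0"
    by (simp add: scale_left_diff_distrib sum_subtractf)
  have "killing a e = g e" if "e \<in> B" for e
    using independentD[OF B(2) fin subset_refl 0 that] by simp
  then have "killing a y = g y" for y
    using eqI[of "killing a" g y] g by (simp add: killing_add killing_scale killing_P)
  then show ?thesis by blast
qed

text \<open>Let \<open>a\<close> represent the functional sending \<open>y\<close> to the trace of
  \<open>d \<circ> ad y\<close>. Then \<open>e = d - ad a\<close> has trace zero against every
  \<open>ad y\<close>. Since \<open>killing (e x) y\<close> equals the trace of
  \<open>e \<circ> ad [y, x]\<close>, the vector \<open>e x\<close> lies in the radical.\<close>

theorem derivation_inner: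
  assumes "derivation d"
  shows "\<exists>a. \<forall>x. P (d x - b x a) = 0"
proof -
  have d: "lin d" "\<And>x y. d (b x y) = b (d x) y + b x (d y)"
    using assms by (auto simp: derivation_def)
  define g where "g y = tr (\<lambda>z. d (b z y))" for y
  have "\<exists>a. \<forall>y. killing a y = g y"
    by (rule killing_represents)
       (simp_all add: g_def add_right scale_right lin_add[OF d(1)] lin_scale[OF d(1)] tr_add tr_scale bracket_P)
  then obtain a where a: "\<And>y. killing a y = g y" by blast
  define e where "e z = d z - b z a" for z
  have le: "lin e" unfolding e_def by (rule pair.linear_compose_sub[OF d(1) lin_left])
  have e: "e (b x y) = b (e x) y + b x (e y)" for x y
    by (simp add: e_def d(2) jacobi[of x y a] diff_left diff_right)
  have tr_e: "tr (\<lambda>z. e (b z y)) = 0" for y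
  proof -
    have "tr (\<lambda>z. e (b z y)) = g y - killing y a" by (simp only: e_def tr_diff g_def killing_def)
    then show ?thesis by (simp add: a killing_sym[of y])
  qed
  have "P (e x) = 0" for x
  proof (rule killing_radical_central)
    have "killing (e x) y = 0" for y
    proof -
      have "killing (e x) y = tr (\<lambda>z. b (e (b z x)) y - b (b (e z) x) y)"
        unfolding killing_def by (simp add: e add_left)
      also have "\<dots> = tr (\<lambda>z. b (e (b z x)) y) - tr (\<lambda>z. b (b (e z) x) y)"
        by (rule tr_diff)
      also have "tr (\<lambda>z. b (e (b z x)) y) = tr (\<lambda>z. e (b (b z y) x))"
        using tr_commute[OF lin_left lin_comp[OF le lin_left]]
          by (rule trans) (rule refl)
      also have "tr (\<lambda>z. b (b (e z) x) y) = tr (\<lambda>z. e (b (b z x) y))"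
        by (rule tr_commute[OF lin_comp[OF lin_left lin_left] le])
      also have "tr (\<lambda>z. e (b (b z y) x)) - tr (\<lambda>z. e (b (b z x) y)) = tr (\<lambda>z. e (b z (b y x)))"
        by (simp add: jacobi[of _ y x] lin_add[OF le] tr_diff[symmetric])
      finally show ?thesis using tr_e by simp
    qed
    then show "e x \<in> killing_radical" by (simp add: killing_radical_def)
  qed
  then show ?thesis by (auto simp: e_def)
qed

end

section \<open>Module homomorphisms and direct sums\<close>

context vector_space
begin

section \<open>Bases of direct sums and dimension from coordinates\<close>

lemma independent_Un:
  assumes B: "independent B" and C: "finite C" "independent C" and BC: "span B \<inter> span C = {0}"
  shows "independent (B \<union> C) \<and> B \<inter> C = {}"
proof -
  have "independent (B \<union> C')" if "C' \<subseteq> C" "finite C'" for C'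
    using that(2,1)
  proof (induction C')
    case empty
    then show ?case using B by simp
  next
    case (insert v C')
    have "v \<notin> span (B \<union> C')"
    proof
      assume "v \<in> span (B \<union> C')"
      then obtain x y where xy: "v = x + y" "x \<in> span B" "y \<in> span C'" by (auto simp: span_Un)
      have "y \<in> span C" "v \<in> span C" using xy(3) insert.prems span_mono[of C' C] by (auto intro: span_base)
      then have "x \<in> span C" using xy(1) span_diff[of v C y] by simp
      then have "x = 0" using xy(2) BC by blast
      then have "v \<in> span C'" using xy by simp
      moreover have "C' \<subseteq> C - {v}" using insert by auto
      ultimately show False using C(2) insert.prems span_mono unfolding dependent_def by blast
    qed
    then show ?case using insert by (simp add: independent_insertI)
  qed
  moreover have "B \<inter> C = {}"
  proof (rule ccontr)
    assume "B \<inter> C \<noteq> {}"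
    then obtain v where v: "v \<in> B" "v \<in> C" by blast
    then have "v = 0" using BC span_base by blast
    with v B show False using dependent_zero by blast
  qed
  ultimately show ?thesis using C(1) by blast
qed

text \<open>The vectors whose coordinates are unit vectors form a basis. The basis is returned, and
  not only its size, because bases of complementary spaces of derivations will be united.\<close>

lemma dim_if_coordinates:
  assumes W: "subspace W" and J: "finite J"
    and add: "\<And>x y j. x \<in> W \<Longrightarrow> y \<in> W \<Longrightarrow> j \<in> J \<Longrightarrow> \<chi> (x + y) j = \<chi> x j + \<chi> y j"
    and scl: "\<And>c x j. x \<in> W \<Longrightarrow> j \<in> J \<Longrightarrow> \<chi> (scale c x) j = c * \<chi> x j"
    and inj: "\<And>x. x \<in> W \<Longrightarrow> (\<And>j. j \<in> J \<Longrightarrow> \<chi> x j = 0) \<Longrightarrow> x = 0"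
    and surj: "\<And>a. \<exists>x\<in>W. \<forall>j\<in>J. \<chi> x j = a j"
  shows "\<exists>B\<subseteq>W. finite B \<and> independent B \<and> W \<subseteq> span B \<and> card B = card J"
proof -
  have "\<forall>j. \<exists>x\<in>W. \<forall>i\<in>J. \<chi> x i = (if i = j then 1 else 0)"
    using surj[of "\<lambda>i. if i = j then 1 else 0" for j] by blast
  then obtain e where e: "\<And>j. e j \<in> W" "\<And>i j. i \<in> J \<Longrightarrow> \<chi> (e j) i = (if i = j then 1 else 0)"
    by metis
  have zero: "\<chi> 0 i = 0" if "i \<in> J" for i
    using scl[OF subspace_0[OF W] that, of 0] by simp
  have comb: "(\<Sum>j\<in>A. scale (a j) (e j)) \<in> W \<and>
      (\<forall>i\<in>J. \<chi> (\<Sum>j\<in>A. scale (a j) (e j)) i = (\<Sum>j\<in>A. a j * \<chi> (e j) i))" if "finite A" for a A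
    using that
  proof (induction A)
    case empty
    then show ?case using zero subspace_0[OF W] by simp
  next
    case (insert j A)
    then show ?case using e(1) by (auto simp: add scl subspace_scale[OF W] intro!: subspace_add[OF W])
  qed
  have coord: "\<chi> (\<Sum>j\<in>J. scale (a j) (e j)) i = a i" if "i \<in> J" for a i
    using comb[OF J] that J by (simp add: e(2) if_distrib[of "\<lambda>x. _ * x"] cong: if_cong)
  have inj_e: "inj_on e J"
  proof (rule inj_onI)
    fix i j assume "i \<in> J" "j \<in> J" "e i = e j"
    then show "i = j" using e(2)[of i i] e(2)[of i j] by (auto split: if_splits)
  qed
  have "independent (e ` J)"
  proof (rule independent_if_scalars_zero)
    show "finite (e ` J)" using J by simp
    fix f x assume sum: "(\<Sum>x\<in>e ` J. scale (f x) x) = 0" and "x \<in> e ` J"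
    then obtain i where i: "i \<in> J" "x = e i" by blast
    have "(\<Sum>j\<in>J. scale (f (e j)) (e j)) = 0" using sum by (simp add: sum.reindex[OF inj_e])
    then have "f (e i) = \<chi> 0 i" using coord[OF i(1), of "\<lambda>j. f (e j)"] by simp
    then show "f x = 0" using i zero by simp
  qed
  moreover have "x \<in> span (e ` J)" if x: "x \<in> W" for x
  proof -
    let ?y = "\<Sum>j\<in>J. scale (\<chi> x j) (e j)"
    have y: "?y \<in> W" using comb[OF J] by blast
    have minus: "scale (- 1) ?y \<in> W" by (rule subspace_scale[OF W y])
    have "x + scale (- 1) ?y = 0"
    proof (rule inj)
      show "x + scale (- 1) ?y \<in> W" using x minus by (rule subspace_add[OF W])
      show "\<chi> (x + scale (- 1) ?y) j = 0" if "j \<in> J" for j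
        using add[OF x minus that] scl[OF y that, of "- 1"] coord[OF that, of "\<chi> x"] by simp
    qed
    then have "x = ?y" by simp
    also have "\<dots> \<in> span (e ` J)" by (intro span_sum span_scale span_base) auto
    finally show ?thesis .
  qed
  ultimately show ?thesis using e(1) J card_image[OF inj_e] by (intro exI[of _ "e ` J"]) auto
qed

end

section \<open>Linear maps and module homomorphisms on carriers\<close>

lemma vector_space_fun_scale:
  assumes "vector_space scl" shows "vector_space (fun_scale scl)"
proof -
  interpret vector_space scl by fact
  show ?thesis
    by unfold_locales (auto simp: fun_scale_def fun_eq_iff scale_right_distrib scale_left_distrib)
qed

lemma linear_on_sum:
  assumes sv: "vector_space sv" and sw: "vector_space sw" and V: "module.subspace sv V"
    and f: "linear_on sv sw V f" and x: "\<And>k. k \<in> A \<Longrightarrow> x k \<in> V"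
  shows "f (\<Sum>k\<in>A. sv (c k) (x k)) = (\<Sum>k\<in>A. sw (c k) (f (x k)))"
proof -
  interpret v: vector_space sv by fact
  interpret w: vector_space sw by fact
  have 0: "f 0 = 0"
    using f v.subspace_0[OF V] by (metis linear_on_def v.scale_zero_left w.scale_zero_left)
  show ?thesis
    using x
  proof (induction A rule: infinite_finite_induct)
    case (insert k A)
    have "(\<Sum>k\<in>A. sv (c k) (x k)) \<in> V"
      using insert.prems by (intro v.subspace_sum[OF V] v.subspace_scale[OF V]) auto
    moreover have "sv (c k) (x k) \<in> V" using insert.prems v.subspace_scale[OF V] by blast
    moreover have "x k \<in> V" using insert.prems by blast
    ultimately show ?case using insert f by (simp add: linear_on_def)
  qed (simp_all add: 0)
qed

lemma linear_on_0:
  assumes sv: "vector_space sv" and sw: "vector_space sw" and V: "module.subspace sv V"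
    and f: "linear_on sv sw V f"
  shows "f 0 = 0"
  using linear_on_sum[OF assms, of "{}"] by simp

lemma linear_on_comp:
  "linear_on sv sw V f \<Longrightarrow> linear_on sw su W g \<Longrightarrow> f ` V \<subseteq> W \<Longrightarrow> linear_on sv su V (\<lambda>x. g (f x))"
  by (auto simp: linear_on_def image_subset_iff)

lemma linear_on_inv_into:
  assumes sv: "vector_space sv" and sw: "vector_space sw" and V: "module.subspace sv V"
    and f: "linear_on sv sw V f" and bij: "bij_betw f V W"
  shows "linear_on sw sv W (inv_into V f)"
proof -
  interpret v: vector_space sv by fact
  let ?g = "inv_into V f"
  have g: "?g y \<in> V" "f (?g y) = y" if "y \<in> W" for y
    using that bij by (auto simp: bij_betw_def inv_into_into f_inv_into_f)
  have gf: "?g (f x) = x" if "x \<in> V" for x using bij that by (simp add: bij_betw_def)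
  show ?thesis
    unfolding linear_on_def
  proof (intro conjI ballI allI)
    fix x y assume "x \<in> W" "y \<in> W"
    then have "x + y = f (?g x + ?g y)" using f g by (simp add: linear_on_def)
    then show "?g (x + y) = ?g x + ?g y"
      using gf[of "?g x + ?g y"] g \<open>x \<in> W\<close> \<open>y \<in> W\<close> v.subspace_add[OF V] by simp
  next
    fix c x assume "x \<in> W"
    then have "sw c x = f (sv c (?g x))" using f g by (simp add: linear_on_def)
    then show "?g (sw c x) = sv c (?g x)"
      using gf[of "sv c (?g x)"] g \<open>x \<in> W\<close> v.subspace_scale[OF V] by simp
  qed
qed

lemma rmod_iso_inverse:
  assumes "vector_space (mscale M)" "vector_space (mscale N)" "module.subspace (mscale M) (mcarrier M)"
    and act: "\<And>v x. v \<in> mcarrier M \<Longrightarrow> x \<in> S \<Longrightarrow> mact M v x \<in> mcarrier M"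
    and f: "rmod_iso S M N f"
  shows "rmod_iso S N M (inv_into (mcarrier M) f)"
proof -
  let ?g = "inv_into (mcarrier M) f"
  have bij: "bij_betw f (mcarrier M) (mcarrier N)" and lin: "linear_on (mscale M) (mscale N) (mcarrier M) f"
    and eq: "\<And>v x. v \<in> mcarrier M \<Longrightarrow> x \<in> S \<Longrightarrow> f (mact M v x) = mact N (f v) x"
    using f by (auto simp: rmod_iso_def)
  have g: "?g y \<in> mcarrier M" "f (?g y) = y" if "y \<in> mcarrier N" for y
    using that bij by (auto simp: bij_betw_def inv_into_into f_inv_into_f)
  have "?g (mact N v x) = mact M (?g v) x" if "v \<in> mcarrier N" "x \<in> S" for v x
  proof -
    have "?g (f (mact M (?g v) x)) = mact M (?g v) x"
      using bij act[OF g(1)[OF that(1)] that(2)] by (intro inv_into_f_f) (auto simp: bij_betw_def)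
    then show ?thesis using eq[OF g(1)[OF that(1)] that(2)] g(2)[OF that(1)] by simp
  qed
  then show ?thesis
    using linear_on_inv_into[OF assms(1-3) lin bij] bij_betw_inv_into[OF bij] by (simp add: rmod_iso_def)
qed

lemma rmod_iso_comp:
  "rmod_iso S M N f \<Longrightarrow> rmod_iso S N L g \<Longrightarrow> rmod_iso S M L (\<lambda>x. g (f x))"
proof -
  assume f: "rmod_iso S M N f" and g: "rmod_iso S N L g"
  have im: "f ` mcarrier M = mcarrier N" using f by (simp add: rmod_iso_def bij_betw_def)
  have "bij_betw (\<lambda>x. g (f x)) (mcarrier M) (mcarrier L)"
    using bij_betw_trans[of f "mcarrier M" "mcarrier N" g "mcarrier L"] f g
    by (simp add: rmod_iso_def comp_def)
  moreover have "linear_on (mscale M) (mscale L) (mcarrier M) (\<lambda>x. g (f x))"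
    using linear_on_comp im f g unfolding rmod_iso_def by blast
  ultimately show ?thesis using f g im unfolding rmod_iso_def by (metis imageI)
qed

definition rmod_hom ::
  "'a set \<Rightarrow> ('v::ab_group_add, 'a) rmod \<Rightarrow> ('w::ab_group_add, 'a) rmod \<Rightarrow> ('v \<Rightarrow> 'w) \<Rightarrow> bool" where
  "rmod_hom S M N f \<longleftrightarrow> f ` mcarrier M \<subseteq> mcarrier N \<and>
     linear_on (mscale M) (mscale N) (mcarrier M) f \<and>
     (\<forall>v\<in>mcarrier M. \<forall>x\<in>S. f (mact M v x) = mact N (f v) x)"

lemma rmod_iso_imp_hom: "rmod_iso S M N f \<Longrightarrow> rmod_hom S M N f"
  by (auto simp: rmod_iso_def rmod_hom_def bij_betw_def)

lemma rmod_hom_comp: "rmod_hom S M N f \<Longrightarrow> rmod_hom S N L g \<Longrightarrow> rmod_hom S M L (\<lambda>x. g (f x))"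
  unfolding rmod_hom_def using linear_on_comp[of "mscale M" "mscale N" "mcarrier M" f "mscale L" "mcarrier N" g]
  by (auto simp: image_subset_iff)

lemma rmodule_simps:
  assumes "rmodule scl br S M"
  shows "vector_space (mscale M)" "module.subspace (mscale M) (mcarrier M)"
    and "\<And>v x. v \<in> mcarrier M \<Longrightarrow> x \<in> S \<Longrightarrow> mact M v x \<in> mcarrier M"
    and "\<And>v w x. v \<in> mcarrier M \<Longrightarrow> w \<in> mcarrier M \<Longrightarrow> x \<in> S \<Longrightarrow> mact M (v + w) x = mact M v x + mact M w x"
    and "\<And>c v x. v \<in> mcarrier M \<Longrightarrow> x \<in> S \<Longrightarrow> mact M (mscale M c v) x = mscale M c (mact M v x)"
  using assms by (auto simp: rmodule_def linear_on_def)

text \<open>First half of Schur's lemma: kernel and image are submodules, so a nonzero homomorphism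
  between simple modules is bijective.\<close>

lemma simple_rmodule_hom_zero_or_iso:
  assumes M: "simple_rmodule scl br S M" and N: "simple_rmodule scl br S N"
    and f: "rmod_hom S M N f" and noniso: "\<not> rmod_isomorphic S M N" and x: "x \<in> mcarrier M"
  shows "f x = 0"
proof (rule ccontr)
  assume fx: "f x \<noteq> 0"
  have "rmodule scl br S M" "rmodule scl br S N" using M N by (auto simp: simple_rmodule_def)
  note m = rmodule_simps[OF this(1)] and n = rmodule_simps[OF this(2)]
  interpret m: vector_space "mscale M" by (rule m(1))
  interpret n: vector_space "mscale N" by (rule n(1))
  have im: "f v \<in> mcarrier N" if "v \<in> mcarrier M" for v using f that by (auto simp: rmod_hom_def)
  have lin: "linear_on (mscale M) (mscale N) (mcarrier M) f"
    and eq: "\<And>v x. v \<in> mcarrier M \<Longrightarrow> x \<in> S \<Longrightarrow> f (mact M v x) = mact N (f v) x"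
    using f by (auto simp: rmod_hom_def)
  have f0: "f 0 = 0" by (rule linear_on_0[OF m(1) n(1) m(2) lin])
  have N0: "mact N 0 s = 0" if "s \<in> S" for s
    using n(5)[OF n.subspace_0[OF n(2)] that, of 0] by simp
  have add: "f (v + w) = f v + f w" if "v \<in> mcarrier M" "w \<in> mcarrier M" for v w
    using lin that by (simp add: linear_on_def)
  have scl: "f (mscale M c v) = mscale N c (f v)" if "v \<in> mcarrier M" for c v
    using lin that by (simp add: linear_on_def)
  let ?K = "{v \<in> mcarrier M. f v = 0}"
  have "submodule_of S M ?K"
    unfolding submodule_of_def
    using m by (auto intro!: m.subspaceI simp: f0 m.subspace_0 m.subspace_add m.subspace_scale add scl eq N0)
  then have "?K = {0} \<or> ?K = mcarrier M" using M by (auto simp: simple_rmodule_def)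
  then have K: "?K = {0}" using fx x by auto
  have "submodule_of S N (f ` mcarrier M)"
    unfolding submodule_of_def
  proof (intro conjI ballI)
    show "n.subspace (f ` mcarrier M)"
    proof (rule n.subspaceI)
      show "0 \<in> f ` mcarrier M" using f0 m.subspace_0[OF m(2)] by (metis imageI)
      fix u v assume "u \<in> f ` mcarrier M" "v \<in> f ` mcarrier M"
      then show "u + v \<in> f ` mcarrier M"
        using add m.subspace_add[OF m(2)] by (metis (no_types, lifting) image_iff)
    next
      fix c u assume "u \<in> f ` mcarrier M"
      then show "mscale N c u \<in> f ` mcarrier M"
        using scl m.subspace_scale[OF m(2)] by (metis (no_types, lifting) image_iff)
    qed
    fix v s assume "v \<in> f ` mcarrier M" "s \<in> S"
    then show "mact N v s \<in> f ` mcarrier M"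
      using eq m(3) by (metis (no_types, lifting) image_iff)
  qed (use im in auto)
  then have "f ` mcarrier M = {0} \<or> f ` mcarrier M = mcarrier N" using N by (auto simp: simple_rmodule_def)
  moreover have "f x \<in> f ` mcarrier M" using x by blast
  ultimately have surj: "f ` mcarrier M = mcarrier N" using fx by auto
  have "inj_on f (mcarrier M)"
  proof (rule inj_onI)
    fix u v assume uv: "u \<in> mcarrier M" "v \<in> mcarrier M" "f u = f v"
    have v': "mscale M (- 1) v \<in> mcarrier M" by (rule m.subspace_scale[OF m(2) uv(2)])
    have "f (u + mscale M (- 1) v) = 0"
      using uv add[OF uv(1) v'] scl[OF uv(2), of "- 1"] by simp
    then have "u + mscale M (- 1) v \<in> ?K" using m.subspace_add[OF m(2) uv(1) v'] by simp
    then show "u = v" using K by simp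
  qed
  then have "rmod_iso S M N f" using surj lin eq by (simp add: rmod_iso_def bij_betw_def)
  then show False using noniso by (auto simp: rmod_isomorphic_def)
qed

text \<open>Second half of Schur's lemma: the eigenspace of \<open>c\<close> is a nonzero submodule.
  The eigenvector is a hypothesis because its existence needs finite dimension, which the type of
  the module does not provide.\<close>

lemma simple_rmodule_endo_scalar:
  assumes M: "simple_rmodule scl br S M" and f: "rmod_hom S M M f"
    and v: "v \<in> mcarrier M" "v \<noteq> 0" "f v = mscale M c v" and x: "x \<in> mcarrier M"
  shows "f x = mscale M c x"
proof -
  have "rmodule scl br S M" using M by (auto simp: simple_rmodule_def)
  note m = rmodule_simps[OF this]
  interpret m: vector_space "mscale M" by (rule m(1))
  have lin: "linear_on (mscale M) (mscale M) (mcarrier M) f"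
    and eq: "\<And>v x. v \<in> mcarrier M \<Longrightarrow> x \<in> S \<Longrightarrow> f (mact M v x) = mact M (f v) x"
    using f by (auto simp: rmod_hom_def)
  have f0: "f 0 = 0" by (rule linear_on_0[OF m(1) m(1) m(2) lin])
  have add: "f (v + w) = f v + f w" if "v \<in> mcarrier M" "w \<in> mcarrier M" for v w
    using lin that by (simp add: linear_on_def)
  have scl: "f (mscale M c v) = mscale M c (f v)" if "v \<in> mcarrier M" for c v
    using lin that by (simp add: linear_on_def)
  let ?K = "{v \<in> mcarrier M. f v = mscale M c v}"
  have "submodule_of S M ?K"
    unfolding submodule_of_def
    using m by (auto intro!: m.subspaceI simp: f0 m.subspace_0 m.subspace_add m.subspace_scale add scl eq
        m.scale_right_distrib mult.commute)
  then have "?K = {0} \<or> ?K = mcarrier M" using M by (auto simp: simple_rmodule_def)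
  then show ?thesis using v x by auto
qed

section \<open>Projections onto the summands of a direct sum\<close>

context complex_fd
begin

sublocale fs: vector_space "fun_scale scale :: complex \<Rightarrow> ('a \<Rightarrow> 'a) \<Rightarrow> 'a \<Rightarrow> 'a"
  by (rule vector_space_fun_scale[OF vector_space_axioms])

lemma linear_on_extend:
  assumes U: "subspace U" and f: "linear_on scale scale U f"
  shows "\<exists>g. lin g \<and> (\<forall>x\<in>U. g x = f x)"
proof -
  obtain B where B: "B \<subseteq> U" "independent B" "U \<subseteq> span B"
    using maximal_independent_subset by blast
  obtain g where g: "lin g" "\<forall>x\<in>B. g x = f x"
    using pair.linear_independent_extend[OF B(2)] by blast
  have f0: "f 0 = 0" using f subspace_0[OF U] linear_on_0 vector_space_axioms U by blast
  have "subspace {x \<in> U. g x = f x}"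
    using f by (intro subspaceI) (auto simp: f0 lin_zero[OF g(1)] lin_add[OF g(1)] lin_scale[OF g(1)]
      linear_on_def subspace_0[OF U] subspace_add[OF U] subspace_scale[OF U])
  then have "span B \<subseteq> {x \<in> U. g x = f x}" using B(1) g(2) by (intro span_minimal) auto
  with B(3) g(1) show ?thesis by blast
qed

text \<open>The components with respect to the decomposition, as linear maps of the whole space; off
  \<open>W\<close> their values are arbitrary.\<close>

definition projections :: "'i set \<Rightarrow> ('i \<Rightarrow> 'a set) \<Rightarrow> 'a set \<Rightarrow> ('i \<Rightarrow> 'a \<Rightarrow> 'a) \<Rightarrow> bool" where
  "projections A U W Q \<longleftrightarrow>
     (\<forall>j\<in>A. lin (Q j)) \<and> (\<forall>j\<in>A. \<forall>x\<in>W. Q j x \<in> U j) \<and> (\<forall>x\<in>W. (\<Sum>j\<in>A. Q j x) = x) \<and>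
     (\<forall>g. (\<forall>j\<in>A. g j \<in> U j) \<longrightarrow> (\<Sum>j\<in>A. g j) \<in> W \<and> (\<forall>j\<in>A. Q j (\<Sum>j\<in>A. g j) = g j))"

lemma projections_exist:
  assumes A: "finite A" and U: "\<And>j. j \<in> A \<Longrightarrow> subspace (U j)" and W: "direct_sum_decomp A U W"
  shows "\<exists>Q. projections A U W Q"
proof -
  have bij: "bij_betw (\<lambda>x. \<Sum>j\<in>A. x j) (PiE A U) W" using W by (simp add: direct_sum_decomp_def)
  define q where "q = inv_into (PiE A U) (\<lambda>x. \<Sum>j\<in>A. x j)"
  have q1: "q x j \<in> U j" if "x \<in> W" "j \<in> A" for x j
    using bij that inv_into_into[of x "\<lambda>x. \<Sum>j\<in>A. x j" "PiE A U"] by (auto simp: q_def bij_betw_def)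
  have q2: "(\<Sum>j\<in>A. q x j) = x" if "x \<in> W" for x
    using bij that f_inv_into_f[of x "\<lambda>x. \<Sum>j\<in>A. x j" "PiE A U"] by (auto simp: q_def bij_betw_def)
  have gW: "(\<Sum>j\<in>A. g j) \<in> W" and qg: "j \<in> A \<Longrightarrow> q (\<Sum>j\<in>A. g j) j = g j"
    if g: "\<And>j. j \<in> A \<Longrightarrow> g j \<in> U j" for g j
  proof -
    \<comment> \<open>Elements of \<open>PiE\<close> are \<open>undefined\<close> off
      \<open>A\<close>, so \<open>g\<close> itself need not be one.\<close>
    have r: "restrict g A \<in> PiE A U" using g by auto
    have s: "(\<Sum>j\<in>A. restrict g A j) = (\<Sum>j\<in>A. g j)" by (intro sum.cong) auto
    have "W = (\<lambda>x. \<Sum>j\<in>A. x j) ` PiE A U" using bij by (simp add: bij_betw_def)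
    then show "(\<Sum>j\<in>A. g j) \<in> W" using imageI[OF r, of "\<lambda>x. \<Sum>j\<in>A. x j"] s by simp
    have "q (\<Sum>j\<in>A. restrict g A j) = restrict g A"
      unfolding q_def using bij r by (intro inv_into_f_f) (auto simp: bij_betw_def)
    then show "q (\<Sum>j\<in>A. g j) j = g j" if "j \<in> A" using that s by simp
  qed
  have W': "subspace W"
  proof (rule subspaceI)
    show "0 \<in> W" using gW[of "\<lambda>_. 0"] U subspace_0 by simp
    show "x + y \<in> W" if "x \<in> W" "y \<in> W" for x y
      using gW[of "\<lambda>j. q x j + q y j"] that q1 q2 U by (simp add: sum.distrib subspace_add)
    show "c *s x \<in> W" if "x \<in> W" for c x
      using gW[of "\<lambda>j. c *s q x j"] that q1 q2 U by (simp add: scale_sum_right[symmetric] subspace_scale)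
  qed
  have "linear_on scale scale W (\<lambda>x. q x j)" if j: "j \<in> A" for j
    unfolding linear_on_def
  proof (intro conjI ballI allI)
    show "q (x + y) j = q x j + q y j" if "x \<in> W" "y \<in> W" for x y
      using qg[of "\<lambda>j. q x j + q y j" j] j that q1 q2 U by (simp add: sum.distrib subspace_add)
    show "q (c *s x) j = c *s q x j" if "x \<in> W" for c x
      using qg[of "\<lambda>j. c *s q x j" j] j that q1 q2 U by (simp add: scale_sum_right[symmetric] subspace_scale)
  qed
  then have "\<forall>j\<in>A. \<exists>g. lin g \<and> (\<forall>x\<in>W. g x = q x j)" using linear_on_extend[OF W'] by blast
  then obtain Q where Q: "\<And>j. j \<in> A \<Longrightarrow> lin (Q j)" "\<And>j x. j \<in> A \<Longrightarrow> x \<in> W \<Longrightarrow> Q j x = q x j"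
    by metis
  have "Q j (\<Sum>j\<in>A. g j) = g j" if "\<And>j. j \<in> A \<Longrightarrow> g j \<in> U j" "j \<in> A" for g j
    using Q(2)[OF that(2) gW[of g, OF that(1)]] qg[of g j, OF that] by simp
  then have "projections A U W Q"
    unfolding projections_def using Q q1 q2 gW by (auto simp: Q(2))
  then show ?thesis by blast
qed

end

section \<open>Homomorphisms between isotypic decompositions\<close>

lemma bracket_rmod_simps [simp]:
  "mcarrier (bracket_rmod scl br J) = J"
  "mscale (bracket_rmod scl br J) = scl"
  "mact (bracket_rmod scl br J) = br"
  by (simp_all add: bracket_rmod_def)

text \<open>A common frame for (a), where \<open>X = S\<close>, and (b), where \<open>X = I\<close>.
  The \<open>M i\<close> are abstract models of the simple modules, the first \<open>p\<close> of
  which occur in \<open>X\<close>; \<alpha> and \<psi> embed them as the chosen copies, so that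
  scalars can be compared across copies.\<close>

locale isotypic_homs = complex_fd scale Basis
  for scale :: "complex \<Rightarrow> 'a::ab_group_add \<Rightarrow> 'a" (infixr \<open>*s\<close> 75) and Basis +
  fixes br :: "'a \<Rightarrow> 'a \<Rightarrow> 'a" and S X I :: "'a set" and PX :: "'a \<Rightarrow> 'a"
    and p q :: nat and n m :: "nat \<Rightarrow> nat"
    and M :: "nat \<Rightarrow> ('b::ab_group_add, 'a) rmod"
    and Xc Ic :: "nat \<Rightarrow> nat \<Rightarrow> 'a set" and \<alpha> \<psi> :: "nat \<Rightarrow> nat \<Rightarrow> 'b \<Rightarrow> 'a"
  assumes lin_br: "lin (\<lambda>v. br v s)"
    and lin_PX: "lin PX" and PX_in: "PX x \<in> X" and PX_id: "x \<in> X \<Longrightarrow> PX x = x"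
    and p_le_q: "p \<le> q"
    and M_simple: "i < q \<Longrightarrow> simple_rmodule scale br S (M i)"
    and M_noniso: "i < q \<Longrightarrow> j < q \<Longrightarrow> i \<noteq> j \<Longrightarrow> \<not> rmod_isomorphic S (M i) (M j)"
    and Xc: "i < p \<Longrightarrow> k < n i \<Longrightarrow> submodule_of S (bracket_rmod scale br X) (Xc i k) \<and>
      rmod_iso S (M i) (bracket_rmod scale br (Xc i k)) (\<alpha> i k)"
    and X_decomp: "direct_sum_decomp (SIGMA i:{..<p}. {..<n i}) (\<lambda>(i, k). Xc i k) X"
    and Ic: "i < q \<Longrightarrow> k < m i \<Longrightarrow> submodule_of S (bracket_rmod scale br I) (Ic i k) \<and>
      rmod_iso S (M i) (bracket_rmod scale br (Ic i k)) (\<psi> i k)"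
    and I_decomp: "direct_sum_decomp (SIGMA i:{..<q}. {..<m i}) (\<lambda>(i, k). Ic i k) I"
begin

text \<open>Module homomorphisms from \<open>X\<close> to \<open>I\<close>, continued by
  \<open>0\<close> on the complement \<open>ker PX\<close>: each is then represented once, and sums
  are pointwise.\<close>

definition homs :: "('a \<Rightarrow> 'a) set" where
  "homs = {d. lin d \<and> d ` X \<subseteq> I \<and> (\<forall>x. PX x = 0 \<longrightarrow> d x = 0) \<and>
     (\<forall>x\<in>X. \<forall>s\<in>S. d (br x s) = br (d x) s)}"

abbreviation "XJ \<equiv> SIGMA i:{..<p}. {..<n i}"
abbreviation "IJ \<equiv> SIGMA i:{..<q}. {..<m i}"

definition "XQ = (SOME Q. projections XJ (\<lambda>(i, k). Xc i k) X Q)"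
definition "IQ = (SOME Q. projections IJ (\<lambda>(i, k). Ic i k) I Q)"

lemma Xc_sub:
  assumes "i < p" "k < n i"
  shows "subspace (Xc i k)" "Xc i k \<subseteq> X" "\<And>x s. x \<in> Xc i k \<Longrightarrow> s \<in> S \<Longrightarrow> br x s \<in> Xc i k"
  using Xc[OF assms] by (auto simp: submodule_of_def)

lemma Ic_sub:
  assumes "i < q" "k < m i"
  shows "subspace (Ic i k)" "Ic i k \<subseteq> I" "\<And>x s. x \<in> Ic i k \<Longrightarrow> s \<in> S \<Longrightarrow> br x s \<in> Ic i k"
  using Ic[OF assms] by (auto simp: submodule_of_def)

lemma XQ: "projections XJ (\<lambda>(i, k). Xc i k) X XQ"
proof -
  have "\<exists>Q. projections XJ (\<lambda>(i, k). Xc i k) X Q"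
    using X_decomp Xc_sub(1) by (intro projections_exist) auto
  then show ?thesis unfolding XQ_def by (rule someI_ex)
qed

lemma IQ: "projections IJ (\<lambda>(i, k). Ic i k) I IQ"
proof -
  have "\<exists>Q. projections IJ (\<lambda>(i, k). Ic i k) I Q"
    using I_decomp Ic_sub(1) by (intro projections_exist) auto
  then show ?thesis unfolding IQ_def by (rule someI_ex)
qed

lemma projections_equivariant:
  assumes Q: "projections A U W Q" and j: "j \<in> A" and x: "x \<in> W" and s: "s \<in> S"
    and U: "\<And>j x s. j \<in> A \<Longrightarrow> x \<in> U j \<Longrightarrow> s \<in> S \<Longrightarrow> br x s \<in> U j"
  shows "Q j (br x s) = br (Q j x) s"
proof -
  have "br x s = br (\<Sum>j\<in>A. Q j x) s" using Q x by (simp add: projections_def)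
  also have "\<dots> = (\<Sum>j\<in>A. br (Q j x) s)" by (rule lin_sum[OF lin_br])
  finally have eq: "br x s = (\<Sum>j\<in>A. br (Q j x) s)" .
  have "\<forall>j\<in>A. br (Q j x) s \<in> U j" using Q x s U by (auto simp: projections_def)
  then have "Q j (\<Sum>i\<in>A. br (Q i x) s) = br (Q j x) s"
    using Q j unfolding projections_def by (elim conjE allE[of _ "\<lambda>i. br (Q i x) s"]) auto
  then show ?thesis unfolding eq[symmetric] .
qed

lemma projections_component:
  assumes Q: "projections A U W Q" and A: "finite A" "j \<in> A" "k \<in> A" and x: "x \<in> U k"
    and U: "\<And>j. j \<in> A \<Longrightarrow> subspace (U j)"
  shows "Q j x = (if j = k then x else 0)"
proof -
  define g where "g i = (if i = k then x else 0)" for i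
  have "\<forall>i\<in>A. g i \<in> U i" using x U subspace_0 by (auto simp: g_def)
  then have "Q j (\<Sum>i\<in>A. g i) = g j" using Q A(2) by (simp add: projections_def)
  moreover have "(\<Sum>i\<in>A. g i) = x" using A by (simp add: g_def)
  ultimately show ?thesis by (simp add: g_def)
qed

lemmas XQ_lin = XQ[unfolded projections_def, THEN conjunct1, rule_format]
  and XQ_in = XQ[unfolded projections_def, THEN conjunct2, THEN conjunct1, rule_format]
  and XQ_sum = XQ[unfolded projections_def, THEN conjunct2, THEN conjunct2, THEN conjunct1, rule_format]
  and IQ_lin = IQ[unfolded projections_def, THEN conjunct1, rule_format]
  and IQ_in = IQ[unfolded projections_def, THEN conjunct2, THEN conjunct1, rule_format]
  and IQ_sum = IQ[unfolded projections_def, THEN conjunct2, THEN conjunct2, THEN conjunct1, rule_format]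

lemma I_subspace: "subspace I"
proof (rule subspaceI)
  have *: "(\<Sum>j\<in>IJ. g j) \<in> I" if "\<forall>j\<in>IJ. g j \<in> (\<lambda>(i, k). Ic i k) j" for g
    using IQ that unfolding projections_def by blast
  show "0 \<in> I" using *[of "\<lambda>_. 0"] Ic_sub(1) subspace_0 by auto
  show "x + y \<in> I" if "x \<in> I" "y \<in> I" for x y
  proof -
    have "(\<Sum>j\<in>IJ. IQ j x + IQ j y) \<in> I"
      using IQ_in that Ic_sub(1) by (intro *) (auto intro!: subspace_add)
    then show ?thesis using that by (simp add: sum.distrib IQ_sum)
  qed
  show "c *s x \<in> I" if "x \<in> I" for c x
  proof -
    have "(\<Sum>j\<in>IJ. c *s IQ j x) \<in> I"
      using IQ_in that Ic_sub(1) by (intro *) (auto intro!: subspace_scale)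
    then show ?thesis using that by (simp add: scale_sum_right[symmetric] IQ_sum)
  qed
qed

lemma M_module:
  assumes "i < q"
  shows "vector_space (mscale (M i))" "module.subspace (mscale (M i)) (mcarrier (M i))"
    and "\<And>v x. v \<in> mcarrier (M i) \<Longrightarrow> x \<in> S \<Longrightarrow> mact (M i) v x \<in> mcarrier (M i)"
  using M_simple[OF assms] rmodule_simps[of scale br S "M i"] by (auto simp: simple_rmodule_def)

lemma M_nonzero: "i < q \<Longrightarrow> \<exists>x\<in>mcarrier (M i). x \<noteq> 0"
  using M_simple[of i] module.subspace_0[of "mscale (M i)" "mcarrier (M i)"] M_module[of i]
  by (auto simp: simple_rmodule_def module_iff_vector_space)

lemma \<psi>:
  assumes "i < q" "l < m i"
  shows "bij_betw (\<psi> i l) (mcarrier (M i)) (Ic i l)"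
    and "linear_on (mscale (M i)) scale (mcarrier (M i)) (\<psi> i l)"
    and "\<And>x s. x \<in> mcarrier (M i) \<Longrightarrow> s \<in> S \<Longrightarrow> \<psi> i l (mact (M i) x s) = br (\<psi> i l x) s"
    and "\<psi> i l 0 = 0" and "\<And>x. x \<in> mcarrier (M i) \<Longrightarrow> \<psi> i l x \<in> Ic i l"
    and "rmod_iso S (bracket_rmod scale br (Ic i l)) (M i) (inv_into (mcarrier (M i)) (\<psi> i l))"
proof -
  have iso: "rmod_iso S (M i) (bracket_rmod scale br (Ic i l)) (\<psi> i l)"
    using Ic[OF assms] by blast
  then show "bij_betw (\<psi> i l) (mcarrier (M i)) (Ic i l)"
    and lin: "linear_on (mscale (M i)) scale (mcarrier (M i)) (\<psi> i l)"
    and "\<And>x s. x \<in> mcarrier (M i) \<Longrightarrow> s \<in> S \<Longrightarrow> \<psi> i l (mact (M i) x s) = br (\<psi> i l x) s"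
    by (auto simp: rmod_iso_def)
  then show "\<And>x. x \<in> mcarrier (M i) \<Longrightarrow> \<psi> i l x \<in> Ic i l" by (auto simp: bij_betw_def)
  show "\<psi> i l 0 = 0"
    by (rule linear_on_0[OF M_module(1)[OF assms(1)] vector_space_axioms M_module(2)[OF assms(1)] lin])
  show "rmod_iso S (bracket_rmod scale br (Ic i l)) (M i) (inv_into (mcarrier (M i)) (\<psi> i l))"
    using M_module[OF assms(1)] iso vector_space_axioms by (intro rmod_iso_inverse) auto
qed

lemma \<psi>_eq_0_iff:
  assumes "i < q" "l < m i" "x \<in> mcarrier (M i)"
  shows "\<psi> i l x = 0 \<longleftrightarrow> x = 0"
proof -
  have "0 \<in> mcarrier (M i)"
    using module.subspace_0[OF _ M_module(2)[OF assms(1)]] M_module(1)[OF assms(1)]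
    by (simp add: module_iff_vector_space)
  then show ?thesis
    using \<psi>(1,4)[OF assms(1,2)] assms(3) by (metis bij_betw_def inj_onD)
qed

lemma \<alpha>:
  assumes "i < p" "k < n i"
  shows "bij_betw (\<alpha> i k) (mcarrier (M i)) (Xc i k)"
    and "linear_on (mscale (M i)) scale (mcarrier (M i)) (\<alpha> i k)"
    and "\<And>x. x \<in> mcarrier (M i) \<Longrightarrow> \<alpha> i k x \<in> Xc i k"
    and "\<And>x. x \<in> mcarrier (M i) \<Longrightarrow> \<alpha> i k x \<in> X"
    and "rmod_hom S (M i) (bracket_rmod scale br X) (\<alpha> i k)"
    and "rmod_iso S (bracket_rmod scale br (Xc i k)) (M i) (inv_into (mcarrier (M i)) (\<alpha> i k))"
proof -
  have iso: "rmod_iso S (M i) (bracket_rmod scale br (Xc i k)) (\<alpha> i k)"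
    using Xc[OF assms] by blast
  then show "bij_betw (\<alpha> i k) (mcarrier (M i)) (Xc i k)"
    and "linear_on (mscale (M i)) scale (mcarrier (M i)) (\<alpha> i k)"
    by (auto simp: rmod_iso_def)
  then show *: "\<And>x. x \<in> mcarrier (M i) \<Longrightarrow> \<alpha> i k x \<in> Xc i k" by (auto simp: bij_betw_def)
  then show **: "\<And>x. x \<in> mcarrier (M i) \<Longrightarrow> \<alpha> i k x \<in> X" using Xc_sub[OF assms] by blast
  show "rmod_hom S (M i) (bracket_rmod scale br X) (\<alpha> i k)"
    using iso ** by (auto simp: rmod_iso_def rmod_hom_def)
  have "i < q" using assms p_le_q by simp
  from M_module[OF this] show
    "rmod_iso S (bracket_rmod scale br (Xc i k)) (M i) (inv_into (mcarrier (M i)) (\<alpha> i k))"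
    using iso vector_space_axioms by (intro rmod_iso_inverse) auto
qed

lemma linear_on_if_lin: "lin f \<Longrightarrow> linear_on scale scale U f"
  by (simp add: lin_iff linear_on_def)

section \<open>Components between simple summands\<close>

lemma component_hom:
  assumes d: "d \<in> homs" and ik: "i < p" "k < n i" and jl: "j < q" "l < m j"
  shows "rmod_hom S (M i) (bracket_rmod scale br (Ic j l)) (\<lambda>x. IQ (j, l) (d (\<alpha> i k x)))"
proof -
  have dX: "rmod_hom S (bracket_rmod scale br X) (bracket_rmod scale br I) d"
    using d by (auto simp: homs_def rmod_hom_def linear_on_if_lin)
  have "IQ (j, l) (br x s) = br (IQ (j, l) x) s" if "x \<in> I" "s \<in> S" for x s
    using jl that Ic_sub(3) by (intro projections_equivariant[OF IQ]) auto
  then have "rmod_hom S (bracket_rmod scale br I) (bracket_rmod scale br (Ic j l)) (IQ (j, l))"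
    using jl IQ_in[of "(j, l)"] IQ_lin[of "(j, l)"] by (auto simp: rmod_hom_def linear_on_if_lin)
  from rmod_hom_comp[OF rmod_hom_comp[OF \<alpha>(5)[OF ik] dX] this] show ?thesis .
qed

text \<open>Composed with the inverse of \<open>\<psi> j l\<close>, the component becomes a
  homomorphism between non-isomorphic simple modules.\<close>

lemma component_off_diagonal:
  assumes d: "d \<in> homs" and ik: "i < p" "k < n i" and jl: "j < q" "l < m j" and ij: "i \<noteq> j"
    and x: "x \<in> mcarrier (M i)"
  shows "IQ (j, l) (d (\<alpha> i k x)) = 0"
proof -
  have i: "i < q" using ik p_le_q by simp
  let ?h = "\<lambda>x. IQ (j, l) (d (\<alpha> i k x))" and ?g = "inv_into (mcarrier (M j)) (\<psi> j l)"
  note h = component_hom[OF d ik jl]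
  have "?g (?h x) = 0"
    using simple_rmodule_hom_zero_or_iso[OF M_simple[OF i] M_simple[OF jl(1)]
      rmod_hom_comp[OF h rmod_iso_imp_hom[OF \<psi>(6)[OF jl]]] M_noniso[OF i jl(1) ij] x] .
  moreover have "?h x \<in> Ic j l" using h x by (auto simp: rmod_hom_def)
  ultimately show ?thesis using \<psi>(1,4)[OF jl] by (metis bij_betw_inv_into_right)
qed

lemma component_diagonal:
  assumes d: "d \<in> homs" and ik: "i < p" "k < n i" and l: "l < m i"
  shows "\<exists>c. \<forall>x\<in>mcarrier (M i). IQ (i, l) (d (\<alpha> i k x)) = c *s \<psi> i l x"
proof -
  have i: "i < q" using ik p_le_q by simp
  let ?h = "\<lambda>x. IQ (i, l) (d (\<alpha> i k x))" and ?g = "inv_into (mcarrier (M i)) (\<psi> i l)"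
  note h = component_hom[OF d ik i l] and iso = \<psi>(6)[OF i l]
  note f = rmod_hom_comp[OF h rmod_iso_imp_hom[OF iso]]
  have g: "?g y \<in> mcarrier (M i)" "\<psi> i l (?g y) = y" if "y \<in> Ic i l" for y
    using iso \<psi>(1)[OF i l] that by (auto simp: rmod_iso_def bij_betw_def f_inv_into_f)
  have h_in: "?h x \<in> Ic i l" if "x \<in> mcarrier (M i)" for x
    using h that by (auto simp: rmod_hom_def)
  have gl: "linear_on scale (mscale (M i)) (Ic i l) ?g" "?g ` Ic i l \<subseteq> mcarrier (M i)"
    using iso by (auto simp: rmod_iso_def bij_betw_def)
  have hl: "linear_on (mscale (M i)) scale (mcarrier (M i)) ?h" using h by (simp add: rmod_hom_def)
  \<comment> \<open>The endomorphism of \<open>M i\<close> is transported to the copy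
    \<open>Ic i l\<close>, a subspace of the finite-dimensional algebra, where an eigenvector
    exists.\<close>
  have "linear_on scale scale (Ic i l) (\<lambda>y. ?h (?g y))" by (rule linear_on_comp[OF gl(1) hl gl(2)])
  then obtain e where e: "lin e" "\<And>y. y \<in> Ic i l \<Longrightarrow> e y = ?h (?g y)"
    using linear_on_extend[OF Ic_sub(1)[OF i l]] by blast
  obtain x0 where x0: "x0 \<in> mcarrier (M i)" "x0 \<noteq> 0" using M_nonzero[OF i] by blast
  have 1: "e ` Ic i l \<subseteq> Ic i l" using e(2) h_in g(1) by auto
  have 2: "\<psi> i l x0 \<in> Ic i l" "\<psi> i l x0 \<notin> {0}"
    using \<psi>(5)[OF i l x0(1)] \<psi>_eq_0_iff[OF i l x0(1)] x0(2) by auto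
  obtain v c where v: "v \<in> Ic i l" "v \<noteq> 0" "e v = c *s v"
    using eigenvector_mod_subspace[OF e(1) Ic_sub(1)[OF i l] 1 subspace_single_0 2] by auto
  have "?g (?h (?g v)) = mscale (M i) c (?g v)"
    using iso v e(2)[OF v(1)] by (auto simp: rmod_iso_def linear_on_def)
  moreover have "?g v \<noteq> 0" using g(2)[OF v(1)] \<psi>(4)[OF i l] v(2) by metis
  ultimately have scalar: "?g (?h x) = mscale (M i) c x" if "x \<in> mcarrier (M i)" for x
    using simple_rmodule_endo_scalar[OF M_simple[OF i] f g(1)[OF v(1)]] that by blast
  have "?h x = c *s \<psi> i l x" if x: "x \<in> mcarrier (M i)" for x
  proof -
    have "?h x = \<psi> i l (mscale (M i) c x)" using g(2)[OF h_in[OF x]] scalar[OF x] by simp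
    then show ?thesis using \<psi>(2)[OF i l] x by (simp add: linear_on_def)
  qed
  then show ?thesis by blast
qed

definition coefficient :: "('a \<Rightarrow> 'a) \<Rightarrow> nat \<Rightarrow> nat \<Rightarrow> nat \<Rightarrow> complex" where
  "coefficient d i k l = (SOME c. \<forall>x\<in>mcarrier (M i). IQ (i, l) (d (\<alpha> i k x)) = c *s \<psi> i l x)"

lemma coefficient:
  assumes "d \<in> homs" "i < p" "k < n i" "l < m i" "x \<in> mcarrier (M i)"
  shows "IQ (i, l) (d (\<alpha> i k x)) = coefficient d i k l *s \<psi> i l x"
  using someI_ex[OF component_diagonal[OF assms(1-4)]] assms(5) unfolding coefficient_def by blast

lemma coefficient_eqI:
  assumes "d \<in> homs" "i < p" "k < n i" "l < m i"
    and "\<And>x. x \<in> mcarrier (M i) \<Longrightarrow> IQ (i, l) (d (\<alpha> i k x)) = c *s \<psi> i l x"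
  shows "coefficient d i k l = c"
proof -
  have i: "i < q" using assms(2) p_le_q by simp
  obtain x where x: "x \<in> mcarrier (M i)" "x \<noteq> 0" using M_nonzero[OF i] by blast
  have "coefficient d i k l *s \<psi> i l x = c *s \<psi> i l x"
    using trans[OF coefficient[OF assms(1-4) x(1), symmetric] assms(5)[OF x(1)]] .
  moreover have "\<psi> i l x \<noteq> 0" using \<psi>_eq_0_iff[OF i assms(4) x(1)] x(2) by blast
  ultimately show ?thesis by (simp only: scale_cancel_right) simp
qed

lemma homs_expand:
  assumes d: "d \<in> homs" and ik: "i < p" "k < n i" and x: "x \<in> mcarrier (M i)"
  shows "d (\<alpha> i k x) = (\<Sum>l<m i. coefficient d i k l *s \<psi> i l x)"
proof -
  have i: "i < q" using ik p_le_q by simp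
  have "d (\<alpha> i k x) \<in> I" using d \<alpha>(4)[OF ik x] by (auto simp: homs_def)
  then have "d (\<alpha> i k x) = (\<Sum>jl\<in>IJ. IQ jl (d (\<alpha> i k x)))" by (simp add: IQ_sum)
  also have "\<dots> = (\<Sum>j<q. \<Sum>l<m j. IQ (j, l) (d (\<alpha> i k x)))"
    by (subst sum.Sigma) auto
  also have "\<dots> = (\<Sum>j<q. if j = i then \<Sum>l<m i. IQ (i, l) (d (\<alpha> i k x)) else 0)"
    using component_off_diagonal[OF d ik _ _ _ x] by (intro sum.cong refl) auto
  also have "\<dots> = (\<Sum>l<m i. IQ (i, l) (d (\<alpha> i k x)))" using i by simp
  also have "\<dots> = (\<Sum>l<m i. coefficient d i k l *s \<psi> i l x)"
    using coefficient[OF d ik _ x] by simp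
  finally show ?thesis .
qed

lemma X_subspace: "subspace X"
proof -
  have "range PX = X" using PX_in PX_id by (metis image_subset_iff rangeI subsetI subset_antisym)
  then show ?thesis using pair.linear_subspace_image[OF lin_PX subspace_UNIV] by simp
qed

lemma PX_kernel: "PX (x - PX x) = 0"
  using PX_id[OF PX_in[of x]] by (simp add: lin_diff[OF lin_PX])

lemma homs_PX: assumes "d \<in> homs" shows "d (PX x) = d x"
proof -
  have "lin d" "d (x - PX x) = 0" using assms PX_kernel by (auto simp: homs_def)
  then show ?thesis by (simp add: pair.linear_diff)
qed

lemma homs_eqI:
  assumes d: "d \<in> homs" "e \<in> homs"
    and eq: "\<And>i k x. i < p \<Longrightarrow> k < n i \<Longrightarrow> x \<in> mcarrier (M i) \<Longrightarrow> d (\<alpha> i k x) = e (\<alpha> i k x)"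
  shows "d = e"
proof
  fix z
  have lin: "lin d" "lin e" using d by (auto simp: homs_def)
  have "d (XQ ik (PX z)) = e (XQ ik (PX z))" if ik: "ik \<in> XJ" for ik
  proof -
    obtain i k where [simp]: "ik = (i, k)" by fastforce
    have *: "i < p" "k < n i" using ik by auto
    have "XQ ik (PX z) \<in> Xc i k" using XQ_in[OF ik PX_in] by simp
    then obtain x where "x \<in> mcarrier (M i)" "XQ ik (PX z) = \<alpha> i k x"
      using \<alpha>(1)[OF *] by (auto simp: bij_betw_def)
    then show ?thesis using eq[OF *] by simp
  qed
  then have "(\<Sum>ik\<in>XJ. d (XQ ik (PX z))) = (\<Sum>ik\<in>XJ. e (XQ ik (PX z)))" by (rule sum.cong[OF refl])
  then have "d (PX z) = e (PX z)"
    unfolding lin_sum[OF lin(1), symmetric] lin_sum[OF lin(2), symmetric] XQ_sum[OF PX_in] .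
  then show "d z = e z" using homs_PX[OF d(1), of z] homs_PX[OF d(2), of z] by simp
qed

section \<open>Homomorphisms with prescribed coefficients\<close>

lemma homs_with_coefficients:
  obtains d where "d \<in> homs"
    "\<And>i k x. i < p \<Longrightarrow> k < n i \<Longrightarrow> x \<in> mcarrier (M i) \<Longrightarrow>
      d (\<alpha> i k x) = (\<Sum>l<m i. a i k l *s \<psi> i l x)"
proof -
  let ?b = "\<lambda>i k. inv_into (mcarrier (M i)) (\<alpha> i k)"
  have "\<exists>E. lin E \<and> (\<forall>x\<in>Xc i k. E x = \<psi> i l (?b i k x))" if "i < p" "k < n i" "l < m i" for i k l
  proof -
    have i: "i < q" using that p_le_q by simp
    have "linear_on scale (mscale (M i)) (Xc i k) (?b i k)" "?b i k ` Xc i k \<subseteq> mcarrier (M i)"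
      using \<alpha>(6)[OF that(1,2)] by (auto simp: rmod_iso_def bij_betw_def)
    from linear_on_comp[OF this(1) \<psi>(2)[OF i that(3)] this(2)]
    have "linear_on scale scale (Xc i k) (\<lambda>x. \<psi> i l (?b i k x))" .
    then show ?thesis using linear_on_extend[OF Xc_sub(1)[OF that(1,2)]] by blast
  qed
  then obtain E where E: "\<And>i k l. i < p \<Longrightarrow> k < n i \<Longrightarrow> l < m i \<Longrightarrow> lin (E i k l)"
    "\<And>i k l x. i < p \<Longrightarrow> k < n i \<Longrightarrow> l < m i \<Longrightarrow> x \<in> Xc i k \<Longrightarrow> E i k l x = \<psi> i l (?b i k x)"
    by metis
  have b: "?b i k x \<in> mcarrier (M i)" if "i < p" "k < n i" "x \<in> Xc i k" for i k x
    using \<alpha>(6)[OF that(1,2)] that(3) by (auto simp: rmod_iso_def bij_betw_def)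
  have E_in: "E i k l x \<in> I" if "i < p" "k < n i" "l < m i" "x \<in> Xc i k" for i k l x
    using E(2)[OF that] \<psi>(5)[of i l, OF _ that(3) b[OF that(1,2,4)]] Ic_sub(2)[of i l] that p_le_q by auto
  have E_eq: "E i k l (br x s) = br (E i k l x) s"
    if "i < p" "k < n i" "l < m i" "x \<in> Xc i k" "s \<in> S" for i k l x s
  proof -
    have "?b i k (br x s) = mact (M i) (?b i k x) s"
      using \<alpha>(6)[OF that(1,2)] that(4,5) by (auto simp: rmod_iso_def)
    then show ?thesis
      using E(2)[OF that(1-4)] E(2)[OF that(1-3) Xc_sub(3)[OF that(1,2,4,5)]]
        \<psi>(3)[of i l, OF _ that(3) b[OF that(1,2,4)] that(5)] that(1) p_le_q by simp
  qed
  \<comment> \<open>\<open>E i k l\<close> carries the \<open>k\<close>-th copy of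
    \<open>M i\<close> in \<open>X\<close> onto the \<open>l\<close>-th copy in \<open>I\<close>.
    These maps play the part of matrix units, and \<open>a\<close> supplies their weights.\<close>
  define d where "d z = (\<Sum>(i, k)\<in>XJ. \<Sum>l<m i. a i k l *s E i k l (XQ (i, k) (PX z)))" for z
  have lin_d: "lin d"
    unfolding d_def
    by (rule pair.linear_compose_sum, clarsimp, rule pair.linear_compose_sum, clarsimp,
      rule pair.linear_compose_scale_right, rule lin_comp[OF E(1) lin_comp[OF XQ_lin lin_PX]]) auto
  have XQ_in': "XQ (i, k) x \<in> Xc i k" if "i < p" "k < n i" "x \<in> X" for i k x
    using XQ_in[of "(i, k)" x] that by auto
  have "d \<in> homs"
    unfolding homs_def
  proof (intro CollectI conjI ballI allI impI)
    show "d ` X \<subseteq> I"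
      unfolding d_def using E_in XQ_in' PX_in
      by (auto intro!: subspace_sum[OF I_subspace] subspace_scale[OF I_subspace])
    show "d x = 0" if "PX x = 0" for x
      using that unfolding d_def
      by (intro sum.neutral ballI) (auto intro!: sum.neutral simp: lin_zero[OF XQ_lin] lin_zero[OF E(1)])
    fix x s assume xs: "x \<in> X" "s \<in> S"
    have "br x s = (\<Sum>ik\<in>XJ. br (XQ ik x) s)"
      using XQ_sum[OF xs(1)] lin_sum[OF lin_br, of "\<lambda>ik. XQ ik x" XJ s] by simp
    also have "\<dots> \<in> X"
      using Xc_sub(2,3) XQ_in' xs by (intro subspace_sum[OF X_subspace]) fastforce
    finally have PX_br: "PX (br x s) = br x s" by (rule PX_id)
    have XQ_br: "XQ (i, k) (br x s) = br (XQ (i, k) x) s" if "i < p" "k < n i" for i k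
      using that xs Xc_sub(3) by (intro projections_equivariant[OF XQ]) auto
    have "br (d x) s = (\<Sum>(i, k)\<in>XJ. \<Sum>l<m i. a i k l *s br (E i k l (XQ (i, k) (PX x))) s)"
      unfolding d_def by (simp add: lin_sum[OF lin_br] lin_scale[OF lin_br] case_prod_beta)
    also have "\<dots> = d (br x s)"
      unfolding d_def using E_eq XQ_in' xs
      by (intro sum.cong refl) (auto simp: PX_id PX_br XQ_br intro!: sum.cong)
    finally show "d (br x s) = br (d x) s" by simp
  qed (rule lin_d)
  moreover have "d (\<alpha> i k x) = (\<Sum>l<m i. a i k l *s \<psi> i l x)"
    if ik: "i < p" "k < n i" and x: "x \<in> mcarrier (M i)" for i k x
  proof -
    have XQ_\<alpha>: "XQ (j, h) (\<alpha> i k x) = (if (j, h) = (i, k) then \<alpha> i k x else 0)" if "(j, h) \<in> XJ" for j h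
      using that ik \<alpha>(3)[OF ik x] Xc_sub(1)
      by (intro projections_component[OF XQ]) auto
    have bx: "?b i k (\<alpha> i k x) = x" using \<alpha>(1)[OF ik] x by (simp add: bij_betw_def)
    have "d (\<alpha> i k x) = (\<Sum>jh\<in>XJ. if jh = (i, k) then \<Sum>l<m i. a i k l *s E i k l (\<alpha> i k x) else 0)"
      unfolding d_def using PX_id[OF \<alpha>(4)[OF ik x]] XQ_\<alpha> E(1)
      by (intro sum.cong refl) (auto intro!: sum.neutral simp: lin_zero[OF E(1)] simp del: scale_eq_0_iff split: if_splits)
    also have "\<dots> = (\<Sum>l<m i. a i k l *s E i k l (\<alpha> i k x))" using ik by simp
    also have "\<dots> = (\<Sum>l<m i. a i k l *s \<psi> i l x)"
      using E(2)[OF ik _ \<alpha>(3)[OF ik x]] bx by simp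
    finally show ?thesis .
  qed
  ultimately show ?thesis using that by blast
qed

lemma coefficient_of_expansion:
  assumes d: "d \<in> homs" and ik: "i < p" "k < n i" and l: "l < m i"
    and eq: "\<And>x. x \<in> mcarrier (M i) \<Longrightarrow> d (\<alpha> i k x) = (\<Sum>l<m i. a l *s \<psi> i l x)"
  shows "coefficient d i k l = a l"
proof (rule coefficient_eqI[OF d ik l])
  fix x assume x: "x \<in> mcarrier (M i)"
  have i: "i < q" using ik p_le_q by simp
  have jl: "(i, l) \<in> IJ" using i l by simp
  have "IQ (i, l) (\<psi> i h x) = (if (i, l) = (i, h) then \<psi> i h x else 0)" if "h < m i" for h
    using that i l \<psi>(5)[OF i that x] Ic_sub(1) by (intro projections_component[OF IQ]) auto
  then have "IQ (i, l) (d (\<alpha> i k x)) = (\<Sum>h<m i. if h = l then a l *s \<psi> i l x else 0)"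
    unfolding eq[OF x] lin_sum[OF IQ_lin[OF jl]]
    by (intro sum.cong refl) (auto simp: lin_scale[OF IQ_lin[OF jl]])
  then show "IQ (i, l) (d (\<alpha> i k x)) = a l *s \<psi> i l x" using l by simp
qed

lemma homs_add: "d \<in> homs \<Longrightarrow> e \<in> homs \<Longrightarrow> d + e \<in> homs"
  and homs_scale: "d \<in> homs \<Longrightarrow> fun_scale scale c d \<in> homs"
  and homs_0: "0 \<in> homs"
proof -
  note I = I_subspace
  show "d \<in> homs \<Longrightarrow> e \<in> homs \<Longrightarrow> d + e \<in> homs"
    using I by (auto simp: homs_def lin_iff image_subset_iff subspace_add scale_right_distrib
      lin_add[OF lin_br] algebra_simps)
  show "d \<in> homs \<Longrightarrow> fun_scale scale c d \<in> homs"
    using I by (auto simp: homs_def lin_iff image_subset_iff subspace_scale scale_right_distrib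
      lin_scale[OF lin_br] fun_scale_def mult.commute)
  show "0 \<in> homs"
    using I by (auto simp: homs_def lin_iff image_subset_iff subspace_0 lin_zero[OF lin_br])
qed

lemma subspace_homs: "fs.subspace homs"
  using homs_0 homs_add homs_scale by (intro fs.subspaceI)

lemma coefficient_add:
  assumes d: "d \<in> homs" "e \<in> homs" and "i < p" "k < n i" "l < m i"
  shows "coefficient (d + e) i k l = coefficient d i k l + coefficient e i k l"
  using assms homs_expand[OF d(1)] homs_expand[OF d(2)]
  by (intro coefficient_of_expansion[OF homs_add[OF d], where a = "\<lambda>l. coefficient d i k l + coefficient e i k l"])
     (auto simp: scale_left_distrib sum.distrib)

lemma coefficient_scale:
  assumes d: "d \<in> homs" and "i < p" "k < n i" "l < m i"
  shows "coefficient (fun_scale scale c d) i k l = c * coefficient d i k l"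
  using assms homs_expand[OF d]
  by (intro coefficient_of_expansion[OF homs_scale[OF d], where a = "\<lambda>l. c * coefficient d i k l"])
     (auto simp: fun_scale_def scale_sum_right)

lemma homs_eqI_coefficient:
  assumes d: "d \<in> homs" "e \<in> homs"
    and "\<And>i k l. i < p \<Longrightarrow> k < n i \<Longrightarrow> l < m i \<Longrightarrow> coefficient d i k l = coefficient e i k l"
  shows "d = e"
  using assms(3) homs_expand[OF d(1)] homs_expand[OF d(2)] by (intro homs_eqI[OF d]) simp

lemma homs_coefficient_surj:
  "\<exists>d\<in>homs. \<forall>i<p. \<forall>k<n i. \<forall>l<m i. coefficient d i k l = a i k l"
proof -
  obtain d where d: "d \<in> homs" "\<And>i k x. i < p \<Longrightarrow> k < n i \<Longrightarrow> x \<in> mcarrier (M i) \<Longrightarrow>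
      d (\<alpha> i k x) = (\<Sum>l<m i. a i k l *s \<psi> i l x)"
    by (rule homs_with_coefficients[of a]) blast
  have "coefficient d i k l = a i k l" if "i < p" "k < n i" "l < m i" for i k l
    by (rule coefficient_of_expansion[OF d(1) that d(2)[OF that(1,2)]])
  with d(1) show ?thesis by blast
qed

theorem homs_dimension:
  "\<exists>B\<subseteq>homs. finite B \<and> fs.independent B \<and> homs \<subseteq> fs.span B \<and> card B = (\<Sum>i<p. n i * m i)"
proof -
  let ?J = "SIGMA i:{..<p}. {..<n i} \<times> {..<m i}"
  have zero: "coefficient 0 i k l = 0" if "i < p" "k < n i" "l < m i" for i k l
    using coefficient_add[OF homs_0 homs_0 that] by simp
  have "\<exists>B\<subseteq>homs. finite B \<and> fs.independent B \<and> homs \<subseteq> fs.span B \<and> card B = card ?J"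
  proof (rule fs.dim_if_coordinates[OF subspace_homs, where \<chi> = "\<lambda>d (i, k, l). coefficient d i k l"])
    show "\<exists>d\<in>homs. \<forall>j\<in>?J. (case j of (i, k, l) \<Rightarrow> coefficient d i k l) = a j" for a
      using homs_coefficient_surj[of "\<lambda>i k l. a (i, k, l)"] by fastforce
    show "d = 0" if "d \<in> homs" "\<And>j. j \<in> ?J \<Longrightarrow> (case j of (i, k, l) \<Rightarrow> coefficient d i k l) = 0" for d
    proof (rule homs_eqI_coefficient[OF that(1) homs_0])
      show "coefficient d i k l = coefficient 0 i k l" if "i < p" "k < n i" "l < m i" for i k l
        using \<open>\<And>j. j \<in> ?J \<Longrightarrow> _\<close>[of "(i, k, l)"] that zero[OF that] by simp
    qed
  qed (auto simp: coefficient_add coefficient_scale)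
  then show ?thesis by simp
qed

section \<open>Coefficient matrices as maps of coordinate spaces\<close>

text \<open>The zeros outside the index ranges follow the conventions of \<open>Hom_C\<close> and
  \<open>Hom_sum\<close>, so that the correspondence is a bijection onto the latter.\<close>

definition hom_matrix :: "('a \<Rightarrow> 'a) \<Rightarrow> nat \<Rightarrow> cvec \<Rightarrow> cvec" where
  "hom_matrix d i v l =
     (if i < p \<and> v \<in> cspace (n i) \<and> l < m i then \<Sum>k<n i. coefficient d i k l * v k else 0)"

lemma cspace_add: "v \<in> cspace N \<Longrightarrow> w \<in> cspace N \<Longrightarrow> v + w \<in> cspace N"
  and cspace_scale: "v \<in> cspace N \<Longrightarrow> fun_scale (*) c v \<in> cspace N"
  by (auto simp: cspace_def fun_scale_def)

lemma hom_matrix_in: "hom_matrix d \<in> Hom_sum p n m"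
proof -
  have "linear_on (fun_scale (*)) (fun_scale (*)) (cspace (n i)) (hom_matrix d i)" for i
    unfolding linear_on_def
  proof (intro conjI ballI allI)
    fix v w c assume v: "v \<in> cspace (n i)"
    show "hom_matrix d i (fun_scale (*) c v) = fun_scale (*) c (hom_matrix d i v)"
      using v cspace_scale[OF v, of c]
      by (auto simp: hom_matrix_def fun_eq_iff fun_scale_def sum_distrib_left ac_simps)
    assume w: "w \<in> cspace (n i)"
    show "hom_matrix d i (v + w) = hom_matrix d i v + hom_matrix d i w"
      using v w cspace_add[OF v w]
      by (auto simp: hom_matrix_def fun_eq_iff sum.distrib distrib_left)
  qed
  then show ?thesis
    by (auto simp: Hom_sum_def Hom_C_def hom_matrix_def fun_eq_iff cspace_def)
qed

lemma hom_matrix_unit: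
  assumes "i < p" "k < n i" "l < m i"
  shows "hom_matrix d i (\<lambda>h. if h = k then 1 else 0) l = coefficient d i k l"
proof -
  have "(\<lambda>h. if h = k then 1 else 0) \<in> cspace (n i)" using assms by (simp add: cspace_def)
  then show ?thesis using assms by (simp add: hom_matrix_def if_distrib[of "\<lambda>x. _ * x"] cong: if_cong)
qed

lemma Hom_C_expand:
  assumes f: "f \<in> Hom_C N N'" and v: "v \<in> cspace N"
  shows "f v l = (\<Sum>k<N. f (\<lambda>h. if h = k then 1 else 0) l * v k)"
proof -
  have "f v = f (\<Sum>k<N. fun_scale (*) (v k) (\<lambda>h. if h = k then 1 else 0))"
  proof (rule arg_cong[of _ _ f], rule ext)
    fix h
    have "(\<Sum>k<N. fun_scale (*) (v k) (\<lambda>h. if h = k then 1 else 0)) h = (\<Sum>k<N. if k = h then v k else 0)"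
      by (induction N) (auto simp: fun_scale_def)
    also have "\<dots> = v h" using v by (auto simp: cspace_def)
    finally show "v h = (\<Sum>k<N. fun_scale (*) (v k) (\<lambda>h. if h = k then 1 else 0)) h" by simp
  qed
  also have "\<dots> = (\<Sum>k<N. fun_scale (*) (v k) (f (\<lambda>h. if h = k then 1 else 0)))"
  proof (rule linear_on_sum[where sv = "fun_scale (*)" and sw = "fun_scale (*)" and V = "cspace N"])
    interpret c: vector_space "(*) :: complex \<Rightarrow> complex \<Rightarrow> complex"
      by unfold_locales (auto simp: algebra_simps)
    show vs: "vector_space (fun_scale (*) :: complex \<Rightarrow> cvec \<Rightarrow> cvec)"
      by (rule vector_space_fun_scale[OF c.vector_space_axioms])
    then show "vector_space (fun_scale (*) :: complex \<Rightarrow> cvec \<Rightarrow> cvec)" .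
    from vs interpret cv: vector_space "fun_scale (*) :: complex \<Rightarrow> cvec \<Rightarrow> cvec" .
    show "cv.subspace (cspace N)"
      by (rule cv.subspaceI) (auto simp: cspace_add cspace_scale, simp add: cspace_def)
    show "linear_on (fun_scale (*)) (fun_scale (*)) (cspace N) f" using f by (simp add: Hom_C_def)
  qed (auto simp: cspace_def)
  finally have "f v = (\<Sum>k<N. fun_scale (*) (v k) (f (\<lambda>h. if h = k then 1 else 0)))" .
  then have "f v l = (\<Sum>k<N. fun_scale (*) (v k) (f (\<lambda>h. if h = k then 1 else 0))) l" by simp
  also have "\<dots> = (\<Sum>k<N. f (\<lambda>h. if h = k then 1 else 0) l * v k)"
    by (induction N) (auto simp: fun_scale_def mult.commute)
  finally show ?thesis .
qed

text \<open>The part of \<open>X\<close> belonging to \<open>M i\<close> is the tensor product of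
  \<open>cspace (n i)\<close> with \<open>M i\<close>, and similarly for \<open>I\<close>. By
  Schur's lemma \<open>d\<close> acts there as a linear map of the first factors tensored with the
  identity; the last clause says this for a pure tensor of \<open>v\<close> and
  \<open>x\<close>.\<close>

theorem hom_matrix:
  "linear_on (fun_scale scale) Hom_scale homs hom_matrix \<and> bij_betw hom_matrix homs (Hom_sum p n m) \<and>
   (\<forall>d\<in>homs. \<forall>i<p. \<forall>v\<in>cspace (n i). \<forall>x\<in>mcarrier (M i).
      d (\<Sum>k<n i. v k *s \<alpha> i k x) = (\<Sum>l<m i. hom_matrix d i v l *s \<psi> i l x))"
proof (intro conjI ballI allI impI)
  show "linear_on (fun_scale scale) Hom_scale homs hom_matrix"
    by (auto simp: linear_on_def hom_matrix_def Hom_scale_def fun_scale_def[of _ _ "hom_matrix _"] fun_eq_iff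
      fun_scale_def[of "(*)"] fun_scale_def[of "fun_scale (*)"]
      coefficient_add coefficient_scale sum.distrib distrib_right sum_distrib_left mult.assoc)
  show "bij_betw hom_matrix homs (Hom_sum p n m)"
  proof (rule bij_betw_imageI)
    show "inj_on hom_matrix homs"
    proof (rule inj_onI)
      fix d e assume de: "d \<in> homs" "e \<in> homs" "hom_matrix d = hom_matrix e"
      then show "d = e"
        using hom_matrix_unit[of _ _ _ d] hom_matrix_unit[of _ _ _ e]
        by (intro homs_eqI_coefficient) auto
    qed
    have "F \<in> hom_matrix ` homs" if F: "F \<in> Hom_sum p n m" for F
    proof -
      obtain d where d: "d \<in> homs"
        "\<forall>i<p. \<forall>k<n i. \<forall>l<m i. coefficient d i k l = F i (\<lambda>h. if h = k then 1 else 0) l"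
        using homs_coefficient_surj[of "\<lambda>i k l. F i (\<lambda>h. if h = k then 1 else 0) l"] by blast
      have "hom_matrix d i v l = F i v l" for i v l
      proof (cases "i < p \<and> v \<in> cspace (n i)")
        case True
        then have Fi: "F i \<in> Hom_C (n i) (m i)" using F by (simp add: Hom_sum_def)
        show ?thesis
        proof (cases "l < m i")
          case True
          then show ?thesis using \<open>i < p \<and> _\<close> d(2) Hom_C_expand[OF Fi, of v l] by (simp add: hom_matrix_def)
        next
          case False
          have "F i v \<in> cspace (m i)" using Fi \<open>i < p \<and> _\<close> by (auto simp: Hom_C_def)
          then have "F i v l = 0" using False by (simp add: cspace_def)
          then show ?thesis using False by (simp add: hom_matrix_def)
        qed
      next
        case False
        then have "F i v = 0"
          using F by (cases "i < p") (auto simp: Hom_sum_def Hom_C_def)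
        then show ?thesis using False by (auto simp: hom_matrix_def)
      qed
      then have "hom_matrix d = F" by (simp add: fun_eq_iff)
      with d(1) show ?thesis by blast
    qed
    then show "hom_matrix ` homs = Hom_sum p n m" using hom_matrix_in by auto
  qed
  fix d i v x assume *: "d \<in> homs" "i < p" "v \<in> cspace (n i)" "x \<in> mcarrier (M i)"
  then have lin: "lin d" by (simp add: homs_def)
  have "d (\<Sum>k<n i. v k *s \<alpha> i k x) = (\<Sum>k<n i. v k *s (\<Sum>l<m i. coefficient d i k l *s \<psi> i l x))"
    using homs_expand[OF *(1,2) _ *(4)] by (simp add: lin_sum[OF lin] lin_scale[OF lin])
  also have "\<dots> = (\<Sum>l<m i. \<Sum>k<n i. (coefficient d i k l * v k) *s \<psi> i l x)"
    by (subst sum.swap) (simp add: scale_sum_right mult.commute)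
  also have "\<dots> = (\<Sum>l<m i. hom_matrix d i v l *s \<psi> i l x)"
    using * by (simp add: hom_matrix_def scale_sum_left)
  finally show "d (\<Sum>k<n i. v k *s \<alpha> i k x) = (\<Sum>l<m i. hom_matrix d i v l *s \<psi> i l x)" .
qed

end

section \<open>Derivations of a semisimple Leibniz algebra\<close>

locale leibniz_decomp = leibniz_algebra scl br
  for scl :: "complex \<Rightarrow> 'a::ab_group_add \<Rightarrow> 'a" and br :: "'a \<Rightarrow> 'a \<Rightarrow> 'a" +
  fixes S I :: "'a set"
  assumes I_def: "I = leib_kernel scl br"
    and S_lie: "lie_subalgebra scl br S"
    and S_semisimple: "semisimple_lie (substruct scl br S)"
    and L_decomp: "bij_betw (\<lambda>(x, v). x + v) (S \<times> I) UNIV"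
begin

definition leib_basis :: "'a set" where
  "leib_basis = (SOME B. finite B \<and> independent B \<and> span B = UNIV)"

lemma leib_basis: "finite leib_basis \<and> independent leib_basis \<and> span leib_basis = UNIV"
proof -
  obtain A where A: "finite A" "span A = UNIV" using finite_dim by blast
  obtain B where B: "B \<subseteq> A" "independent B" "A \<subseteq> span B"
    using maximal_independent_subset by blast
  have "span A \<subseteq> span B" by (rule span_minimal[OF B(3) subspace_span])
  then have "finite B \<and> independent B \<and> span B = UNIV"
    using A B finite_subset by auto
  then show ?thesis unfolding leib_basis_def by (rule someI)
qed

sublocale complex_fd scl leib_basis
  using leib_basis by unfold_locales auto

section \<open>The Leibniz kernel and the projection onto \<open>S\<close>\<close>

lemmas lin_left = linear_left and lin_right = linear_right

lemma I_subspace: "subspace I"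
  unfolding I_def leib_kernel_def by (rule subspace_span)

lemma S_subspace: "subspace S" and S_closed: "x \<in> S \<Longrightarrow> y \<in> S \<Longrightarrow> br x y \<in> S"
  and S_alternating: "x \<in> S \<Longrightarrow> br x x = 0"
  using S_lie by (auto simp: lie_subalgebra_def)

text \<open>For \<open>y = z\<close> the right side of the Leibniz identity cancels, so
  \<open>[x, [y, y]] = 0\<close>.\<close>

lemma br_kernel: assumes "v \<in> I" shows "br x v = 0"
  using assms unfolding I_def leib_kernel_def
proof (induction rule: span_induct)
  case base
  show ?case by (rule pair.linear_subspace_kernel[OF lin_right])
next
  case (step v)
  then show ?case using leibniz[of x] by auto
qed

lemma square_in_kernel: "br x x \<in> I"
  unfolding I_def leib_kernel_def by (intro span_base) auto

lemma br_sym_in_kernel: "br x y + br y x \<in> I"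
proof -
  have "br (x + y) (x + y) - br x x - br y y = br x y + br y x"
    by (simp add: lin_add[OF lin_left] lin_add[OF lin_right])
  then show ?thesis using square_in_kernel subspace_diff[OF I_subspace] by metis
qed

text \<open>In \<open>[v, y] + [y, v] \<in> I\<close> the second term is zero.\<close>

lemma kernel_ideal: assumes "v \<in> I" shows "br v y \<in> I"
  using br_sym_in_kernel[of v y] br_kernel[OF assms, of y] by simp

lemma S_I_0: "x \<in> S \<Longrightarrow> x \<in> I \<Longrightarrow> x = 0"
proof -
  assume x: "x \<in> S" "x \<in> I"
  have "(0, x) \<in> S \<times> I" "(x, 0) \<in> S \<times> I"
    using x subspace_0[OF S_subspace] subspace_0[OF I_subspace] by auto
  moreover have "(\<lambda>(x, v). x + v) (0, x) = (\<lambda>(x, v). x + v) (x, 0)" by simp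
  ultimately have "(0, x) = (x, 0)" using L_decomp unfolding bij_betw_def by (blast dest: inj_onD)
  then show ?thesis by simp
qed

definition P :: "'a \<Rightarrow> 'a" where
  "P x = (SOME s. s \<in> S \<and> x - s \<in> I)"

lemma P: "P x \<in> S" "x - P x \<in> I"
proof -
  have "x \<in> (\<lambda>(x, v). x + v) ` (S \<times> I)" using L_decomp by (simp add: bij_betw_def)
  then have "\<exists>s. s \<in> S \<and> x - s \<in> I" by auto
  from someI_ex[OF this] show "P x \<in> S" "x - P x \<in> I" by (auto simp: P_def)
qed

lemma P_eqI: assumes "s \<in> S" "x - s \<in> I" shows "P x = s"
proof -
  have "(x - s) - (x - P x) \<in> I" using assms P subspace_diff[OF I_subspace] by blast
  then have "P x - s \<in> I" by simp
  moreover have "P x - s \<in> S" using assms P subspace_diff[OF S_subspace] by blast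
  ultimately show ?thesis using S_I_0[of "P x - s"] by simp
qed

lemma P_S: "x \<in> S \<Longrightarrow> P x = x"
  by (rule P_eqI) (simp_all add: subspace_0[OF I_subspace])

lemma P_I: "x \<in> I \<Longrightarrow> P x = 0"
  by (rule P_eqI) (simp_all add: subspace_0[OF S_subspace])

lemma P_eq_0_iff: "P x = 0 \<longleftrightarrow> x \<in> I"
  using P(2)[of x] P_I by auto

lemma lin_P: "lin P"
  unfolding lin_iff
proof (intro conjI allI)
  show "P (x + y) = P x + P y" for x y
  proof (rule P_eqI)
    have "(x - P x) + (y - P y) \<in> I" by (rule subspace_add[OF I_subspace P(2) P(2)])
    then show "x + y - (P x + P y) \<in> I" by (simp add: algebra_simps)
  qed (rule subspace_add[OF S_subspace P(1) P(1)])
  show "P (scl c x) = scl c (P x)" for c x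
  proof (rule P_eqI)
    show "scl c x - scl c (P x) \<in> I"
      using subspace_scale[OF I_subspace P(2)] by (simp only: scale_right_diff_distrib[symmetric])
  qed (rule subspace_scale[OF S_subspace P(1)])
qed

lemma br_P: "br x (P y) = br x y"
  using br_kernel[OF P(2), of x y] by (simp add: lin_diff[OF lin_right])

lemma P_br: "P (br x y) = br (P x) (P y)"
proof (rule P_eqI)
  have "br (x - P x) y \<in> I" by (rule kernel_ideal[OF P(2)])
  then show "br x y - br (P x) (P y) \<in> I" by (simp add: lin_diff[OF lin_left] br_P)
qed (intro S_closed P)

text \<open>The derived space of an abelian ideal is zero after one step, so the ideal is solvable.
  The bracket is antisymmetric on \<open>S\<close> because \<open>[x, y] + [y, x]\<close> lies in
  both \<open>S\<close> and \<open>I\<close>.\<close>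

lemma abelian_ideal_trivial:
  assumes J: "subspace J" "J \<subseteq> S" and ideal: "\<And>x y. x \<in> J \<Longrightarrow> y \<in> S \<Longrightarrow> br x y \<in> J"
    and abelian: "\<And>x y. x \<in> J \<Longrightarrow> y \<in> J \<Longrightarrow> br x y = 0"
  shows "J = {0}"
proof -
  let ?G = "substruct scl br S"
  have antisym: "br y x = - br x y" if "x \<in> S" "y \<in> S" for x y
  proof -
    have "br x y + br y x \<in> S" using that S_closed subspace_add[OF S_subspace] by blast
    then have "br x y + br y x = 0" using S_I_0 br_sym_in_kernel by blast
    then show ?thesis by (simp add: add_eq_0_iff)
  qed
  have ideal': "br y x \<in> J" if "x \<in> J" "y \<in> S" for x y
    using antisym[of x y] ideal[OF that] subspace_neg[OF J(1)] that J(2) by auto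
  have "lie_ideal ?G J"
    unfolding lie_ideal_def lie_subspace_def substruct_def
    using J ideal ideal' by (auto simp: subspace_0 subspace_add subspace_scale subset_iff)
  moreover have "derived_space ?G J = {0}"
  proof
    have "lie_subspace ?G {0}"
      by (auto simp: lie_subspace_def substruct_def subspace_0[OF S_subspace])
    then show "derived_space ?G J \<subseteq> {0}"
      unfolding derived_space_def lie_span_def using abelian by (auto simp: substruct_def)
    show "{0} \<subseteq> derived_space ?G J"
      unfolding derived_space_def lie_span_def by (auto simp: lie_subspace_def substruct_def)
  qed
  then have "lie_solvable ?G J"
    unfolding lie_solvable_def by (intro exI[of _ 1]) (simp add: substruct_def)
  ultimately show ?thesis using S_semisimple by (auto simp: semisimple_lie_def substruct_def)
qed

text \<open>Projecting both arguments turns \<open>I\<close> into the central complement of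
  \<open>S\<close>. Since \<open>P\<close> is a homomorphism, an ideal that is abelian modulo
  \<open>I\<close> projects to an abelian ideal of \<open>S\<close>.\<close>

sublocale lie: split_lie scl leib_basis "\<lambda>x y. br (P x) (P y)" P
proof (rule split_lie.intro[OF complex_fd_axioms], rule split_lie_axioms.intro)
  show "lin (\<lambda>x. br (P x) (P y))" for y by (rule lin_comp[OF lin_left lin_P])
  show "lin (\<lambda>y. br (P x) (P y))" for x by (rule lin_comp[OF lin_right lin_P])
  show "br (P x) (P x) = 0" for x by (rule S_alternating[OF P(1)])
  show PP: "P (P x) = P x" for x by (rule P_S[OF P(1)])
  show "br (P (br (P x) (P y))) (P z) = br (P (br (P x) (P z))) (P y) + br (P x) (P (br (P y) (P z)))" for x y z
    using leibniz[of "P x" "P y" "P z"] by (simp add: P_br PP)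
  show "br (P x) (P y) = 0" if "P y = 0" for x y using that by (simp add: lin_zero[OF lin_right])
  show "lin P" by (rule lin_P)
  fix J x
  assume J: "subspace J" "\<And>x y. x \<in> J \<Longrightarrow> br (P x) (P y) \<in> J"
    "\<And>x y. x \<in> J \<Longrightarrow> y \<in> J \<Longrightarrow> P (br (P x) (P y)) = 0" and x: "x \<in> J"
  have "P ` J = {0}"
  proof (rule abelian_ideal_trivial)
    show "subspace (P ` J)" by (rule pair.linear_subspace_image[OF lin_P J(1)])
    show "P ` J \<subseteq> S" using P by auto
    fix u y assume u: "u \<in> P ` J"
    then obtain x where x: "x \<in> J" "u = P x" by blast
    show "br u y \<in> P ` J" if "y \<in> S"
      using J(2)[OF x(1), of y] x(2) P_S[OF that] P_br[of u y] PP
      by (intro image_eqI[of _ _ "br (P x) (P y)"]) auto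
    show "br u y = 0" if "y \<in> P ` J"
      using that J(3)[OF x(1)] x(2) by (auto simp: P_br PP)
  qed
  with x show "P x = 0" by blast
qed

section \<open>Derivations with values in the Leibniz kernel\<close>

lemma Der_iff: "d \<in> Der scl br \<longleftrightarrow> lin d \<and> (\<forall>x y. d (br x y) = br (d x) y + br x (d y))"
  by (simp add: Der_def)

text \<open>The derivation rule turns \<open>d [x, x]\<close> into the symmetrized bracket of
  \<open>d x\<close> and \<open>x\<close>.\<close>

lemma Der_kernel: assumes d: "d \<in> Der scl br" and v: "v \<in> I" shows "d v \<in> I"
proof -
  have lin: "lin d" using d by (simp add: Der_iff)
  have "v \<in> span (range (\<lambda>x. br x x))" using v by (simp add: I_def leib_kernel_def)
  then show ?thesis
  proof (induction rule: span_induct)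
    case base
    show ?case
      by (rule pair.linear_subspace_linear_preimage[OF lin I_subspace])
  next
    case (step v)
    then show ?case using d br_sym_in_kernel by (auto simp: Der_iff)
  qed
qed

lemma Der_ad: "(\<lambda>x. br x a) \<in> Der scl br"
proof -
  have "br (br x y) a = br (br x a) y + br x (br y a)" for x y
    using leibniz[of x y a] by simp
  then show ?thesis using lin_left by (simp add: Der_iff)
qed

lemma Der_diff: "d \<in> Der scl br \<Longrightarrow> e \<in> Der scl br \<Longrightarrow> (\<lambda>x. d x - e x) \<in> Der scl br"
  by (simp add: Der_iff pair.linear_compose_sub lin_diff[OF lin_left] lin_diff[OF lin_right])

text \<open>The term \<open>[x, d y]\<close> of the product rule vanishes for values in
  \<open>I\<close>, and \<open>y\<close> may be replaced by \<open>P y\<close>; what remains is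
  equivariance under \<open>S\<close>.\<close>

lemma Der_I_valued:
  assumes lin: "lin d" and I: "\<And>x. d x \<in> I" and eq: "\<And>x s. s \<in> S \<Longrightarrow> d (br x s) = br (d x) s"
  shows "d \<in> Der scl br"
  unfolding Der_iff
proof (intro conjI allI)
  fix x y
  have "d (br x y) = d (br x (P y))" by (simp only: br_P)
  also have "\<dots> = br (d x) y" using eq[OF P(1), of x y] by (simp only: br_P)
  finally show "d (br x y) = br (d x) y + br x (d y)" by (simp add: br_kernel[OF I])
qed (rule lin)

text \<open>Brings these derivations into the form of \<open>homs\<close> for \<open>X = S\<close>,
  with \<open>P\<close> as the projection.\<close>

lemma Der_SI_iff:
  "d \<in> Der_SI scl br S I \<longleftrightarrow> lin d \<and> d ` S \<subseteq> I \<and> (\<forall>x. P x = 0 \<longrightarrow> d x = 0) \<and>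
     (\<forall>x\<in>S. \<forall>s\<in>S. d (br x s) = br (d x) s)"
proof
  assume "d \<in> Der_SI scl br S I"
  then show "lin d \<and> d ` S \<subseteq> I \<and> (\<forall>x. P x = 0 \<longrightarrow> d x = 0) \<and> (\<forall>x\<in>S. \<forall>s\<in>S. d (br x s) = br (d x) s)"
    by (auto simp: Der_SI_def Der_iff P_eq_0_iff br_kernel image_subset_iff)
next
  assume *: "lin d \<and> d ` S \<subseteq> I \<and> (\<forall>x. P x = 0 \<longrightarrow> d x = 0) \<and> (\<forall>x\<in>S. \<forall>s\<in>S. d (br x s) = br (d x) s)"
  then have lin: "lin d" and dI: "\<And>v. v \<in> I \<Longrightarrow> d v = 0" by (auto simp: P_eq_0_iff)
  have dP: "d x = d (P x)" for x using dI[OF P(2)[of x]] by (simp add: lin_diff[OF lin])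
  have "d \<in> Der scl br"
  proof (rule Der_I_valued[OF lin])
    show "d x \<in> I" for x using * P(1) dP[of x] by auto
    fix x s assume s: "s \<in> S"
    have "d (br x s) = d (br (P x) s)" using dP[of "br x s"] s by (simp add: P_br P_S)
    also have "\<dots> = br (d x) s" using * P(1) s dP[of x] by simp
    finally show "d (br x s) = br (d x) s" .
  qed
  then show "d \<in> Der_SI scl br S I" using * dI by (simp add: Der_SI_def)
qed

text \<open>The counterpart for \<open>X = I\<close>: here the projection onto \<open>X\<close> is
  \<open>x - P x\<close>, whose kernel is \<open>S\<close>.\<close>

lemma Der_II_iff:
  "d \<in> Der_II scl br S I \<longleftrightarrow> lin d \<and> d ` I \<subseteq> I \<and> (\<forall>x. x - P x = 0 \<longrightarrow> d x = 0) \<and>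
     (\<forall>x\<in>I. \<forall>s\<in>S. d (br x s) = br (d x) s)"
proof
  assume d: "d \<in> Der_II scl br S I"
  have "d x = 0" if "x - P x = 0" for x using d P(1)[of x] that by (auto simp: Der_II_def)
  then show "lin d \<and> d ` I \<subseteq> I \<and> (\<forall>x. x - P x = 0 \<longrightarrow> d x = 0) \<and> (\<forall>x\<in>I. \<forall>s\<in>S. d (br x s) = br (d x) s)"
    using d by (auto simp: Der_II_def Der_iff lin_zero[OF lin_right])
next
  assume *: "lin d \<and> d ` I \<subseteq> I \<and> (\<forall>x. x - P x = 0 \<longrightarrow> d x = 0) \<and> (\<forall>x\<in>I. \<forall>s\<in>S. d (br x s) = br (d x) s)"
  then have lin: "lin d" and dS: "\<And>v. v \<in> S \<Longrightarrow> d v = 0" by (auto simp: P_S)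
  have dP: "d x = d (x - P x)" for x using dS[OF P(1)] by (simp add: lin_diff[OF lin])
  have "d \<in> Der scl br"
  proof (rule Der_I_valued[OF lin])
    show "d x \<in> I" for x using * P(2)[of x] dP[of x] by (metis image_subset_iff)
    fix x s assume s: "s \<in> S"
    have "d (br x s) = d (br (x - P x) s)"
      using dP[of "br x s"] s by (simp add: P_br P_S lin_diff[OF lin_left])
    also have "\<dots> = br (d x) s" using * P(2)[of x] s dP[of x] by simp
    finally show "d (br x s) = br (d x) s" .
  qed
  then show "d \<in> Der_II scl br S I" using * dS by (simp add: Der_II_def)
qed

text \<open>As \<open>[S, a]\<close> lies in both \<open>S\<close> and \<open>I\<close>, it is zero.
  Then \<open>a\<close> is in the Killing radical, which has no nonzero element in
  \<open>S\<close>.\<close>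

lemma ad_injective:
  assumes a: "a \<in> S" and zero: "\<And>x. x \<in> S \<Longrightarrow> br x a \<in> I"
  shows "a = 0"
proof -
  have "br (P x) (P a) = 0" for x
    using S_I_0[OF S_closed[OF P(1) a] zero[OF P(1)]] P_S[OF a] by simp
  then have "lie.killing a y = 0" for y
    by (subst lie.killing_sym) (simp add: lie.killing_def tr_zero)
  then have "P a = 0" using lie.killing_radical_central[of a] by (simp add: lie.killing_radical_def)
  then show ?thesis using P_S[OF a] by simp
qed

section \<open>Splitting and counting derivations\<close>

lemma Der_decomposition:
  assumes d: "d \<in> Der scl br"
  obtains a d1 d2 where "a \<in> S" "d1 \<in> Der_SI scl br S I" "d2 \<in> Der_II scl br S I"
    "d = (\<lambda>x. br x a) + d1 + d2"
proof -
  have ld: "lin d" and der: "\<And>x y. d (br x y) = br (d x) y + br x (d y)"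
    using d by (auto simp: Der_iff)
  let ?\<delta> = "\<lambda>x. P (d (P x))"
  have PP: "P (P x) = P x" for x by (rule P_S[OF P(1)])
  have dP: "br z (d (P y)) = br z (d y)" for y z
    using br_kernel[OF Der_kernel[OF d P(2)], of z y] by (simp add: lin_diff[OF ld] lin_diff[OF lin_right])
  have "lie.derivation ?\<delta>"
    unfolding lie.derivation_def
  proof (intro conjI allI)
    show "lin ?\<delta>" by (rule lin_comp[OF lin_P lin_comp[OF ld lin_P]])
    show "?\<delta> (br (P x) (P y)) = br (P (?\<delta> x)) (P y) + br (P x) (P (?\<delta> y))" for x y
      by (simp add: P_br PP der lin_add[OF lin_P] br_P dP)
  qed
  then obtain a' where a': "\<And>x. P (?\<delta> x - br (P x) (P a')) = 0"
    using lie.derivation_inner by blast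
  define a where "a = P a'"
  define e where "e x = d x - br x a" for x
  have e: "e \<in> Der scl br" unfolding e_def by (rule Der_diff[OF d Der_ad])
  then have le: "lin e" and ee: "\<And>x y. e (br x y) = br (e x) y + br x (e y)"
    by (auto simp: Der_iff)
  have eS: "e x \<in> I" if "x \<in> S" for x
  proof -
    have "P (e x) = P (?\<delta> x - br (P x) (P a'))"
      using that by (simp add: e_def a_def P_S lin_diff[OF lin_P] PP)
    then show ?thesis using a' P_eq_0_iff by simp
  qed
  have eI: "e x \<in> I" if "x \<in> I" for x using Der_kernel[OF e that] .
  \<comment> \<open>\<open>e s \<in> I\<close> for \<open>s \<in> S\<close>, so the second term of
    the product rule is zero and \<open>e\<close> is equivariant on both summands. Cutting it by
    \<open>P\<close> and \<open>x - P x\<close> therefore gives derivations again.\<close>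
  have eP: "e (br x s) = br (e x) s" if "x \<in> S \<or> x \<in> I" "s \<in> S" for x s
    using ee[of x s] br_kernel[OF eS[OF that(2)], of x] by simp
  have "(\<lambda>x. e (P x)) \<in> Der_SI scl br S I"
    unfolding Der_SI_iff using lin_comp[OF le lin_P] eS eP
    by (auto simp: P_S S_closed lin_zero[OF le])
  moreover have "(\<lambda>x. e (x - P x)) \<in> Der_II scl br S I"
    unfolding Der_II_iff
    using lin_comp[OF le pair.linear_compose_sub[OF linear_ident lin_P]] eI eP
    by (auto simp: P_I kernel_ideal lin_zero[OF le])
  moreover have "a \<in> S" unfolding a_def by (rule P(1))
  moreover have "d = (\<lambda>x. br x a) + (\<lambda>x. e (P x)) + (\<lambda>x. e (x - P x))"
  proof (rule ext)
    fix x
    have "d x = br x a + e x" by (simp add: e_def)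
    also have "e x = e (P x) + e (x - P x)" by (simp add: lin_diff[OF le])
    finally show "d x = ((\<lambda>x. br x a) + (\<lambda>x. e (P x)) + (\<lambda>x. e (x - P x))) x"
      by (simp add: add.assoc)
  qed
  ultimately show ?thesis using that by blast
qed

text \<open>The three families span by \<open>Der_decomposition\<close>. Their bases are united one
  after the other, which needs only that each new span meets the previous one in
  \<open>0\<close>.\<close>

lemma dim_Der:
  assumes SI: "fs.subspace (Der_SI scl br S I)" "B1 \<subseteq> Der_SI scl br S I" "finite B1"
      "fs.independent B1" "Der_SI scl br S I \<subseteq> fs.span B1"
    and II: "fs.subspace (Der_II scl br S I)" "B2 \<subseteq> Der_II scl br S I" "finite B2"
      "fs.independent B2" "Der_II scl br S I \<subseteq> fs.span B2"
  shows "fs.dim (Der scl br) = dim S + card B1 + card B2"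
proof -
  interpret fp: vector_space_pair scl "fun_scale scl :: complex \<Rightarrow> ('a \<Rightarrow> 'a) \<Rightarrow> 'a \<Rightarrow> 'a" ..
  let ?R = "\<lambda>a x. br x a"
  obtain BS where BS: "BS \<subseteq> S" "independent BS" "S \<subseteq> span BS" "card BS = dim S"
    using basis_exists by blast
  have spanS: "span BS = S" using span_minimal[OF BS(1) S_subspace] BS(3) by auto
  have linR: "Vector_Spaces.linear scl (fun_scale scl) ?R"
    unfolding Vector_Spaces.linear_iff using vector_space_axioms fs.vector_space_axioms
    by (auto simp: fun_eq_iff lin_add[OF lin_right] lin_scale[OF lin_right] fun_scale_def)
  have inj: "inj_on ?R (span BS)"
    unfolding spanS
  proof (rule inj_onI)
    fix a b assume ab: "a \<in> S" "b \<in> S" "?R a = ?R b"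
    have "br x (a - b) \<in> I" for x
      using fun_cong[OF ab(3), of x] subspace_0[OF I_subspace] by (simp add: lin_diff[OF lin_right])
    then have "a - b = 0" using subspace_diff[OF S_subspace ab(1,2)] by (intro ad_injective)
    then show "a = b" by simp
  qed
  let ?BR = "?R ` BS"
  have BR: "fs.independent ?BR" by (rule fp.linear_independent_injective_image[OF linR BS(2) inj])
  have spanR: "fs.span ?BR = ?R ` S" using fp.linear_span_image[OF linR, of BS] spanS by simp
  have span1: "fs.span B1 = Der_SI scl br S I" using fs.span_minimal[OF SI(2,1)] SI(5) by auto
  have span2: "fs.span B2 = Der_II scl br S I" using fs.span_minimal[OF II(2,1)] II(5) by auto
  have dSI: "d x \<in> I" if "d \<in> Der_SI scl br S I" "x \<in> S" for d x
    using that by (auto simp: Der_SI_def)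
  have "fs.span ?BR \<inter> fs.span B1 = {0}"
  proof -
    have "d = 0" if "d \<in> ?R ` S" "d \<in> Der_SI scl br S I" for d
    proof -
      from that(1) obtain a where a: "d = ?R a" "a \<in> S" by (rule imageE)
      have "a = 0" using dSI[OF that(2)] a by (intro ad_injective) auto
      then show ?thesis using a by (simp add: fun_eq_iff lin_zero[OF lin_right])
    qed
    then show ?thesis
      unfolding spanR span1 using fs.span_zero[of ?BR] fs.span_zero[of B1] spanR span1 by auto
  qed
  from fs.independent_Un[OF BR SI(3,4) this]
  have B01: "fs.independent (?BR \<union> B1)" "?BR \<inter> B1 = {}" by auto
  have "fs.span (?BR \<union> B1) \<inter> fs.span B2 = {0}"
  proof -
    have "d = 0" if "d \<in> fs.span (?BR \<union> B1)" "d \<in> Der_II scl br S I" for d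
    proof -
      have "\<exists>e\<in>?R ` S. \<exists>d1\<in>Der_SI scl br S I. d = e + d1"
        using that(1) unfolding fs.span_Un spanR span1 by blast
      then obtain e d1 where e: "e \<in> ?R ` S" "d1 \<in> Der_SI scl br S I" "d = e + d1" by blast
      from e(1) obtain a where "e = ?R a" "a \<in> S" by (rule imageE)
      with e have a: "a \<in> S" "d1 \<in> Der_SI scl br S I" "d = ?R a + d1" by auto
      have dS: "d x = 0" if "x \<in> S" for x using \<open>d \<in> Der_II scl br S I\<close> that by (simp add: Der_II_def)
      have "a = 0"
      \<comment> \<open>Since \<open>d\<close> vanishes on \<open>S\<close>, right multiplication by
        \<open>a\<close> agrees there with \<open>- d1\<close>, which has values in
        \<open>I\<close>.\<close>
      proof (rule ad_injective[OF a(1)])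
        fix x assume x: "x \<in> S"
        have "br x a = - d1 x" using dS[OF x] a(3) by (simp add: eq_neg_iff_add_eq_0)
        then show "br x a \<in> I" using dSI[OF a(2) x] subspace_neg[OF I_subspace] by simp
      qed
      then have d: "d = d1" using a(3) by (simp add: fun_eq_iff lin_zero[OF lin_right])
      have "d x = 0" for x
      proof -
        have "lin d" using that(2) by (simp add: Der_II_iff)
        then have "d x = d (P x) + d (x - P x)" by (simp add: pair.linear_diff)
        moreover have "d (x - P x) = 0" using a(2) P(2)[of x] d by (simp add: Der_SI_def)
        ultimately show ?thesis using dS[OF P(1)[of x]] by simp
      qed
      then show ?thesis by (simp add: fun_eq_iff)
    qed
    then show ?thesis using fs.span_zero[of "?BR \<union> B1"] fs.span_zero[of B2] span2 by auto
  qed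
  from fs.independent_Un[OF B01(1) II(3,4) this]
  have B012: "fs.independent (?BR \<union> B1 \<union> B2)" "(?BR \<union> B1) \<inter> B2 = {}" by auto
  have finBS: "finite BS" using BS(2) by (rule finiteI_independent)
  have "card ?BR = dim S"
    using BS(4) card_image[OF inj_on_subset[OF inj span_superset]] by simp
  then have "card (?BR \<union> B1 \<union> B2) = dim S + card B1 + card B2"
    using finBS SI(3) II(3) B01(2) B012(2) by (simp add: card_Un_disjoint)
  moreover have "?BR \<union> B1 \<union> B2 \<subseteq> Der scl br"
    using Der_ad SI(2) II(2) by (auto simp: Der_SI_def Der_II_def)
  moreover have "Der scl br \<subseteq> fs.span (?BR \<union> B1 \<union> B2)"
  proof
    fix d assume "d \<in> Der scl br"
    then obtain a d1 d2 where d: "a \<in> S" "d1 \<in> Der_SI scl br S I" "d2 \<in> Der_II scl br S I"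
      "d = ?R a + d1 + d2" using Der_decomposition by blast
    have "?R a \<in> fs.span ?BR" unfolding spanR using d(1) by (rule imageI)
    moreover have "d1 \<in> fs.span B1" "d2 \<in> fs.span B2" using d(2,3) span1 span2 by auto
    ultimately show "d \<in> fs.span (?BR \<union> B1 \<union> B2)"
      unfolding d(4) fs.span_Un by blast
  qed
  ultimately show ?thesis using B012(1) by (intro fs.dim_unique) auto
qed

end

theorem theorem4p5:
  fixes scl :: "complex \<Rightarrow> 'a::ab_group_add \<Rightarrow> 'a"
    and br :: "'a \<Rightarrow> 'a \<Rightarrow> 'a"
    and S I :: "'a set"
    and r s :: nat
    and n m :: "nat \<Rightarrow> nat"
    and Si :: "nat \<Rightarrow> 'a set"
    and Scopy :: "nat \<Rightarrow> nat \<Rightarrow> 'a set"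
    and Ii :: "nat \<Rightarrow> ('b::ab_group_add, 'a) rmod"
    and Icopy :: "nat \<Rightarrow> nat \<Rightarrow> 'a set"
    and \<phi> :: "nat \<Rightarrow> nat \<Rightarrow> 'a \<Rightarrow> 'a"
    and \<psi> :: "nat \<Rightarrow> nat \<Rightarrow> 'b \<Rightarrow> 'a"
    and \<theta> :: "nat \<Rightarrow> 'a \<Rightarrow> 'b"
  assumes leibniz: "leibniz_algebra scl br"
    and semisimple: "semisimple_leibniz scl br"
    and I_def: "I = leib_kernel scl br"
    and S_lie: "lie_subalgebra scl br S"
    and S_semisimple: "semisimple_lie (substruct scl br S)"
    and L_decomp: "bij_betw (\<lambda>(x, v). x + v) (S \<times> I) UNIV"
    \<comment> \<open>the decomposition of \<open>S\<close>: \<open>Scopy i k\<close> is the \<open>k\<close>-th copy of \<open>Si i\<close>\<close>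
    and Si_simple: "\<And>i. i < r \<Longrightarrow>
          lie_ideal (substruct scl br S) (Si i) \<and> simple_lie (substruct scl br (Si i))"
    and Si_noniso: "\<And>i j. i < r \<Longrightarrow> j < r \<Longrightarrow> i \<noteq> j \<Longrightarrow>
          \<not> rmod_isomorphic S (bracket_rmod scl br (Si i)) (bracket_rmod scl br (Si j))"
    and n_pos: "\<And>i. i < r \<Longrightarrow> 1 \<le> n i"
    and Scopy: "\<And>i k. i < r \<Longrightarrow> k < n i \<Longrightarrow>
          lie_ideal (substruct scl br S) (Scopy i k) \<and>
          lie_isomorphic (substruct scl br (Si i)) (substruct scl br (Scopy i k)) \<and>
          rmod_iso S (bracket_rmod scl br (Si i)) (bracket_rmod scl br (Scopy i k)) (\<phi> i k)"
    and S_decomp: "direct_sum_decomp (SIGMA i:{..<r}. {..<n i}) (\<lambda>(i, k). Scopy i k) S"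
    \<comment> \<open>the decomposition of \<open>I\<close>: \<open>Icopy i k\<close> is the \<open>k\<close>-th copy of \<open>Ii i\<close>\<close>
    and Ii_simple: "\<And>i. i < r + s \<Longrightarrow> simple_rmodule scl br S (Ii i)"
    and Ii_noniso: "\<And>i j. i < r + s \<Longrightarrow> j < r + s \<Longrightarrow> i \<noteq> j \<Longrightarrow>
          \<not> rmod_isomorphic S (Ii i) (Ii j)"
    and m_pos: "\<And>i. r \<le> i \<Longrightarrow> i < r + s \<Longrightarrow> 1 \<le> m i"
    and Icopy: "\<And>i k. i < r + s \<Longrightarrow> k < m i \<Longrightarrow>
          submodule_of S (bracket_rmod scl br I) (Icopy i k) \<and>
          rmod_iso S (Ii i) (bracket_rmod scl br (Icopy i k)) (\<psi> i k)"
    and I_decomp: "direct_sum_decomp (SIGMA i:{..<r + s}. {..<m i}) (\<lambda>(i, k). Icopy i k) I"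
    and Si_Ii: "\<And>i. i < r \<Longrightarrow> rmod_iso S (bracket_rmod scl br (Si i)) (Ii i) (\<theta> i)"
  shows
    "(\<exists>\<Phi>. linear_on (fun_scale scl) Hom_scale (Der_SI scl br S I) \<Phi> \<and>
          bij_betw \<Phi> (Der_SI scl br S I) (Hom_sum r n m) \<and>
          (\<forall>d\<in>Der_SI scl br S I. \<forall>i<r. \<forall>v\<in>cspace (n i). \<forall>x\<in>Si i.
             d (\<Sum>k<n i. scl (v k) (\<phi> i k x)) = (\<Sum>l<m i. scl (\<Phi> d i v l) (\<psi> i l (\<theta> i x)))))
     \<and> (\<exists>\<Psi>. linear_on (fun_scale scl) Hom_scale (Der_II scl br S I) \<Psi> \<and>
          bij_betw \<Psi> (Der_II scl br S I) (Hom_sum (r + s) m m) \<and>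
          (\<forall>d\<in>Der_II scl br S I. \<forall>i<r + s. \<forall>v\<in>cspace (m i). \<forall>x\<in>mcarrier (Ii i).
             d (\<Sum>k<m i. scl (v k) (\<psi> i k x)) = (\<Sum>l<m i. scl (\<Psi> d i v l) (\<psi> i l x))))
     \<and> vs_dim (fun_scale scl) (Der scl br) =
          vs_dim scl S + (\<Sum>i<r. n i * m i) + (\<Sum>i<r + s. (m i)\<^sup>2)"
proof -
  interpret leibniz_decomp scl br S I
    using leibniz I_def S_lie S_semisimple L_decomp
    by (intro leibniz_decomp.intro leibniz_decomp_axioms.intro)
  have Ii_module: "rmodule scl br S (Ii i)" if "i < r + s" for i
    using Ii_simple[OF that] by (simp add: simple_rmodule_def)
  have ideal: "submodule_of S (bracket_rmod scl br S) J" if "lie_ideal (substruct scl br S) J" for J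
    using that
    by (auto simp: lie_ideal_def lie_subspace_def substruct_def submodule_of_def intro!: subspaceI)
  \<comment> \<open>The common model of both decompositions is \<open>Ii i\<close>, so the copies of
    \<open>Si i\<close> are reached from it through the inverse of \<open>\<theta> i\<close>.
    Evaluating at \<open>\<theta> i x\<close> later restores the formula for
    \<open>x \<in> Si i\<close>.\<close>
  let ?\<alpha> = "\<lambda>i k x. \<phi> i k (inv_into (Si i) (\<theta> i) x)"
  have \<alpha>: "rmod_iso S (Ii i) (bracket_rmod scl br (Scopy i k)) (?\<alpha> i k)" if "i < r" "k < n i" for i k
  proof -
    have i: "i < r + s" using that by simp
    have Si: "submodule_of S (bracket_rmod scl br S) (Si i)" using ideal Si_simple[OF that(1)] by blast
    have "rmod_iso S (Ii i) (bracket_rmod scl br (Si i)) (inv_into (Si i) (\<theta> i))"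
      using rmod_iso_inverse[OF _ rmodule_simps(1)[OF Ii_module[OF i]] _ _ Si_Ii[OF that(1)]]
        vector_space_axioms Si by (auto simp: submodule_of_def)
    then show ?thesis using rmod_iso_comp Scopy[OF that] by blast
  qed
  interpret SI: isotypic_homs scl leib_basis br S S I P r "r + s" n m Ii Scopy Icopy ?\<alpha> \<psi>
    by (rule isotypic_homs.intro[OF complex_fd_axioms], rule isotypic_homs_axioms.intro)
       (use lin_left lin_P P(1) P_S Ii_simple Ii_noniso Scopy ideal \<alpha> S_decomp Icopy I_decomp in auto)
  have lin_Q: "lin (\<lambda>x. x - P x)" by (rule pair.linear_compose_sub[OF linear_ident lin_P])
  \<comment> \<open>Source and target carry the same decomposition here, so the matrices are square
    and contribute \<open>m i * m i\<close>.\<close>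
  interpret II: isotypic_homs scl leib_basis br S I I "\<lambda>x. x - P x" "r + s" "r + s" m m Ii Icopy Icopy \<psi> \<psi>
    by (rule isotypic_homs.intro[OF complex_fd_axioms], rule isotypic_homs_axioms.intro)
       (use lin_left lin_Q P(2) P_I Ii_simple Ii_noniso Icopy I_decomp in auto)
  have SI_homs: "SI.homs = Der_SI scl br S I" by (rule set_eqI) (simp add: SI.homs_def Der_SI_iff)
  have II_homs: "II.homs = Der_II scl br S I" by (rule set_eqI) (simp add: II.homs_def Der_II_iff)
  have "d (\<Sum>k<n i. scl (v k) (\<phi> i k x)) = (\<Sum>l<m i. scl (SI.hom_matrix d i v l) (\<psi> i l (\<theta> i x)))"
    if "d \<in> Der_SI scl br S I" "i < r" "v \<in> cspace (n i)" "x \<in> Si i" for d i v x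
  proof -
    have "bij_betw (\<theta> i) (Si i) (mcarrier (Ii i))" using Si_Ii[OF that(2)] by (simp add: rmod_iso_def)
    then have "\<theta> i x \<in> mcarrier (Ii i)" "inv_into (Si i) (\<theta> i) (\<theta> i x) = x"
      using that(4) by (auto simp: bij_betw_def)
    then show ?thesis using SI.hom_matrix that(1-3) unfolding SI_homs by force
  qed
  moreover obtain B1 where B1: "B1 \<subseteq> Der_SI scl br S I" "finite B1" "fs.independent B1"
    "Der_SI scl br S I \<subseteq> fs.span B1" "card B1 = (\<Sum>i<r. n i * m i)"
    using SI.homs_dimension unfolding SI_homs by blast
  moreover obtain B2 where B2: "B2 \<subseteq> Der_II scl br S I" "finite B2" "fs.independent B2"
    "Der_II scl br S I \<subseteq> fs.span B2" "card B2 = (\<Sum>i<r + s. m i * m i)"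
    using II.homs_dimension unfolding II_homs by blast
  moreover have "fs.dim (Der scl br) = dim S + card B1 + card B2"
    using SI.subspace_homs II.subspace_homs B1 B2 unfolding SI_homs II_homs by (intro dim_Der)
  ultimately show ?thesis
    using SI.hom_matrix II.hom_matrix unfolding SI_homs II_homs
    by (intro conjI exI[of _ SI.hom_matrix] exI[of _ II.hom_matrix]) (simp_all add: power2_eq_square)
qed

end
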